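(* Let $(P,Q)$ be a harmonious quasi-projection pair on a Hilbert $C^*$-module $H$ with $P$ non-trivial, and suppose $$U_PQU_P^*=\begin{pmatrix} A & -\ell(A)U^*\\ U\ell(A) & U(I_{\mathcal{R}(P)}-A)U^*+Q_0\end{pmatrix},$$ where $A\in\mathcal{L}(\mathcal{R}(P))$ is self-adjoint with $A^2-A\ge0$, $U\in\mathcal{L}(\mathcal{R}(P),\mathcal{N}(P))$ is a partial isometry, $Q_0\in\mathcal{L}(\mathcal{N}(P))$ is a projection, $\mathcal{R}(U^* )=\overline{\mathcal{R}(A^2-A)}$ and $U^*Q_0=0$. Then the following are equivalent: (i) $\mathcal{N}(A)=\mathcal{N}(I_{\mathcal{R}(P)}-A)=\{0\}$ and $\mathcal{N}(U^* )=\{0\}$; (ii) $\mathcal{N}(A^2-A)=\{0\}$ and $\mathcal{N}(U^* )=\{0\}$; (iii) $U\in\mathcal{L}(\mathcal{R}(P),\mathcal{N}(P))$ is a unitary operator; (iv) $\mathcal{N}(A)=\mathcal{N}(I_{\mathcal{R}(P)}-A)=\{0\}$ and $\mathcal{N}(Q_{22})=\mathcal{N}(I_{\mathcal{N}(P)}-Q_{22})=\{0\}$, where $Q_{22}=U(I_{\mathcal{R}(P)}-A)U^*+Q_0$.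
   Context: $H$ is a Hilbert module over a $C^*$-algebra, $\mathcal{L}(H)$ the adjointable operators; projections are self-adjoint idempotents; $P$ non-trivial means $P\ne0,I$. A quasi-projection pair is $(P,Q)$ with $P$ a projection, $Q$ an idempotent and $Q^*=(2P-I)Q(2P-I)$; it is harmonious if $\overline{\mathcal{R}(PQ(I-P))}$ and $\overline{\mathcal{R}((I-P)QP)}$ are orthogonally complemented in $H$ (a closed submodule $M$ is orthogonally complemented if $H=M+M^\perp$). $U_P:H\to\mathcal{R}(P)\oplus\mathcal{N}(P)$ is the unitary $h\mapsto(Ph,(I-P)h)^T$, and $\ell(A)=(A^2-A)^{1/2}$. *)

theory Defs
  imports "HOL-Analysis.Analysis"
begin

definition cstar_algebra ::
  "(complex \<Rightarrow> 'a::{real_normed_algebra,banach} \<Rightarrow> 'a) \<Rightarrow> ('a \<Rightarrow> 'a) \<Rightarrow> bool" where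
  "cstar_algebra scA st \<longleftrightarrow>
     (\<forall>r a. scA (complex_of_real r) a = scaleR r a) \<and>
     (\<forall>c a b. scA c (a + b) = scA c a + scA c b) \<and>
     (\<forall>c d a. scA (c + d) a = scA c a + scA d a) \<and>
     (\<forall>c d a. scA (c * d) a = scA c (scA d a)) \<and>
     (\<forall>c a b. scA c (a * b) = scA c a * b \<and> scA c (a * b) = a * scA c b) \<and>
     (\<forall>c a. norm (scA c a) = cmod c * norm a) \<and>
     (\<forall>a b. st (a + b) = st a + st b) \<and>
     (\<forall>c a. st (scA c a) = scA (cnj c) (st a)) \<and>
     (\<forall>a b. st (a * b) = st b * st a) \<and>
     (\<forall>a. st (st a) = a) \<and>
     (\<forall>a. norm (st a * a) = (norm a)\<^sup>2)"

definition cstar_pos :: "('a::ring \<Rightarrow> 'a) \<Rightarrow> 'a \<Rightarrow> bool" where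
  "cstar_pos st a \<longleftrightarrow> (\<exists>b. a = st b * b)"

definition hnorm :: "('h \<Rightarrow> 'h \<Rightarrow> 'a::real_normed_vector) \<Rightarrow> 'h \<Rightarrow> real" where
  "hnorm ip x = sqrt (norm (ip x x))"

definition hconv :: "('h::ab_group_add \<Rightarrow> 'h \<Rightarrow> 'a::real_normed_vector) \<Rightarrow> (nat \<Rightarrow> 'h) \<Rightarrow> 'h \<Rightarrow> bool" where
  "hconv ip X L \<longleftrightarrow> (\<forall>e>0. \<exists>N. \<forall>n\<ge>N. hnorm ip (X n - L) < e)"

definition hcauchy :: "('h::ab_group_add \<Rightarrow> 'h \<Rightarrow> 'a::real_normed_vector) \<Rightarrow> (nat \<Rightarrow> 'h) \<Rightarrow> bool" where
  "hcauchy ip X \<longleftrightarrow> (\<forall>e>0. \<exists>N. \<forall>m\<ge>N. \<forall>n\<ge>N. hnorm ip (X m - X n) < e)"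

definition hilbert_cstar_module ::
  "(complex \<Rightarrow> 'a::{real_normed_algebra,banach} \<Rightarrow> 'a) \<Rightarrow> ('a \<Rightarrow> 'a) \<Rightarrow>
   (complex \<Rightarrow> 'h::ab_group_add \<Rightarrow> 'h) \<Rightarrow> ('h \<Rightarrow> 'a \<Rightarrow> 'h) \<Rightarrow> ('h \<Rightarrow> 'h \<Rightarrow> 'a) \<Rightarrow> bool" where
  "hilbert_cstar_module scA st scH act ip \<longleftrightarrow>
     cstar_algebra scA st \<and>
     (\<forall>c x y. scH c (x + y) = scH c x + scH c y) \<and>
     (\<forall>c d x. scH (c + d) x = scH c x + scH d x) \<and>
     (\<forall>c d x. scH (c * d) x = scH c (scH d x)) \<and>
     (\<forall>x. scH 1 x = x) \<and>
     (\<forall>x y a. act (x + y) a = act x a + act y a) \<and>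
     (\<forall>x a b. act x (a + b) = act x a + act x b) \<and>
     (\<forall>x a b. act x (a * b) = act (act x a) b) \<and>
     (\<forall>c x a. scH c (act x a) = act (scH c x) a \<and> scH c (act x a) = act x (scA c a)) \<and>
     (\<forall>x y z. ip x (y + z) = ip x y + ip x z) \<and>
     (\<forall>c x y. ip x (scH c y) = scA c (ip x y)) \<and>
     (\<forall>x y a. ip x (act y a) = ip x y * a) \<and>
     (\<forall>x y. st (ip x y) = ip y x) \<and>
     (\<forall>x. cstar_pos st (ip x x)) \<and>
     (\<forall>x. ip x x = 0 \<longrightarrow> x = 0) \<and>
     (\<forall>X. hcauchy ip X \<longrightarrow> (\<exists>L. hconv ip X L))"

definition adjointable :: "('h \<Rightarrow> 'h \<Rightarrow> 'a) \<Rightarrow> ('h \<Rightarrow> 'h) \<Rightarrow> bool" where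
  "adjointable ip T \<longleftrightarrow> (\<exists>S. \<forall>x y. ip (T x) y = ip x (S y))"

definition adj :: "('h \<Rightarrow> 'h \<Rightarrow> 'a) \<Rightarrow> ('h \<Rightarrow> 'h) \<Rightarrow> ('h \<Rightarrow> 'h)" where
  "adj ip T = (THE S. \<forall>x y. ip (T x) y = ip x (S y))"

definition is_projection :: "('h \<Rightarrow> 'h \<Rightarrow> 'a) \<Rightarrow> ('h \<Rightarrow> 'h) \<Rightarrow> bool" where
  "is_projection ip P \<longleftrightarrow> adjointable ip P \<and> P \<circ> P = P \<and> adj ip P = P"

definition is_idempotent :: "('h \<Rightarrow> 'h \<Rightarrow> 'a) \<Rightarrow> ('h \<Rightarrow> 'h) \<Rightarrow> bool" where
  "is_idempotent ip Q \<longleftrightarrow> adjointable ip Q \<and> Q \<circ> Q = Q"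

definition kern :: "('h \<Rightarrow> 'h::zero) \<Rightarrow> 'h set" where
  "kern T = {x. T x = 0}"

definition hclosure :: "('h::ab_group_add \<Rightarrow> 'h \<Rightarrow> 'a::real_normed_vector) \<Rightarrow> 'h set \<Rightarrow> 'h set" where
  "hclosure ip S = {x. \<exists>X. (\<forall>n. X n \<in> S) \<and> hconv ip X x}"

definition orth :: "('h \<Rightarrow> 'h \<Rightarrow> 'a::zero) \<Rightarrow> 'h set \<Rightarrow> 'h set" where
  "orth ip M = {y. \<forall>x\<in>M. ip x y = 0}"

definition orth_complemented :: "('h::ab_group_add \<Rightarrow> 'h \<Rightarrow> 'a::zero) \<Rightarrow> 'h set \<Rightarrow> bool" where
  "orth_complemented ip M \<longleftrightarrow> (\<forall>h. \<exists>m\<in>M. \<exists>k\<in>orth ip M. h = m + k)"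

definition quasi_projection_pair :: "('h::ab_group_add \<Rightarrow> 'h \<Rightarrow> 'a) \<Rightarrow> ('h \<Rightarrow> 'h) \<Rightarrow> ('h \<Rightarrow> 'h) \<Rightarrow> bool" where
  "quasi_projection_pair ip P Q \<longleftrightarrow>
     is_projection ip P \<and> is_idempotent ip Q \<and>
     adj ip Q = (\<lambda>x. P x + P x - x) \<circ> Q \<circ> (\<lambda>x. P x + P x - x)"

definition harmonious :: "('h::ab_group_add \<Rightarrow> 'h \<Rightarrow> 'a::real_normed_vector) \<Rightarrow> ('h \<Rightarrow> 'h) \<Rightarrow> ('h \<Rightarrow> 'h) \<Rightarrow> bool" where
  "harmonious ip P Q \<longleftrightarrow> quasi_projection_pair ip P Q \<and>
     orth_complemented ip (hclosure ip (range (\<lambda>x. P (Q (x - P x))))) \<and>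
     orth_complemented ip (hclosure ip (range (\<lambda>x. Q (P x) - P (Q (P x)))))"

text \<open>An operator in L(M,N) is represented by a function on H; only its values on M matter.\<close>
definition adj_between :: "('h \<Rightarrow> 'h \<Rightarrow> 'a) \<Rightarrow> 'h set \<Rightarrow> 'h set \<Rightarrow> ('h \<Rightarrow> 'h) \<Rightarrow> bool" where
  "adj_between ip M N T \<longleftrightarrow> (\<forall>x\<in>M. T x \<in> N) \<and>
     (\<exists>S. (\<forall>y\<in>N. S y \<in> M) \<and> (\<forall>x\<in>M. \<forall>y\<in>N. ip (T x) y = ip x (S y)))"

definition adj_sub :: "('h \<Rightarrow> 'h \<Rightarrow> 'a) \<Rightarrow> 'h set \<Rightarrow> 'h set \<Rightarrow> ('h \<Rightarrow> 'h::zero) \<Rightarrow> ('h \<Rightarrow> 'h)" where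
  "adj_sub ip M N T = (THE S. (\<forall>y. y \<notin> N \<longrightarrow> S y = 0) \<and> (\<forall>y\<in>N. S y \<in> M) \<and>
                         (\<forall>x\<in>M. \<forall>y\<in>N. ip (T x) y = ip x (S y)))"

definition op_pos :: "('h \<Rightarrow> 'h \<Rightarrow> 'a) \<Rightarrow> 'h set \<Rightarrow> ('h \<Rightarrow> 'h::zero) \<Rightarrow> bool" where
  "op_pos ip M T \<longleftrightarrow> (\<exists>B. adj_between ip M M B \<and> (\<forall>x\<in>M. T x = adj_sub ip M M B (B x)))"

definition op_sqrt :: "('h \<Rightarrow> 'h \<Rightarrow> 'a) \<Rightarrow> 'h set \<Rightarrow> ('h \<Rightarrow> 'h::zero) \<Rightarrow> ('h \<Rightarrow> 'h)" where
  "op_sqrt ip M T = (THE L. (\<forall>x. x \<notin> M \<longrightarrow> L x = 0) \<and> adj_between ip M M L \<and> op_pos ip M L \<and>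
                        (\<forall>x\<in>M. L (L x) = T x))"

definition ell :: "('h \<Rightarrow> 'h \<Rightarrow> 'a) \<Rightarrow> 'h set \<Rightarrow> ('h \<Rightarrow> 'h::ab_group_add) \<Rightarrow> ('h \<Rightarrow> 'h)" where
  "ell ip M A = op_sqrt ip M (\<lambda>x. A (A x) - A x)"

definition sub_kern :: "'h set \<Rightarrow> ('h \<Rightarrow> 'h::zero) \<Rightarrow> 'h set" where
  "sub_kern M T = {x\<in>M. T x = 0}"

end

theory Submission
  imports Defs
begin

text \<open>
  Everything except one implication is algebra with adjoints. The exception is that
  \<open>A\<^sup>2 - A\<close> is injective if \<open>U\<close> is unitary, that is, if \<open>A\<^sup>2 - A\<close> has dense range. A vector \<open>x\<close> of its
  kernel is orthogonal to the range and is the limit of some \<open>X n\<close> in the range, so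
  \<open>\<langle>X n, X n\<rangle> + \<langle>x, x\<rangle> = \<langle>X n - x, X n - x\<rangle>\<close> tends to \<open>0\<close>, and \<open>\<langle>x, x\<rangle> = 0\<close> has to be concluded.

  This rests on the inequality \<open>norm (d\<^sup>* d) \<le> K norm (c\<^sup>* c + d\<^sup>* d)\<close> in a \<open>C\<^sup>*\<close>-algebra, which is
  proved without functional calculus. Elements act on the algebra by left multiplication, which supplies
  a unit. Positivity of a self-adjoint \<open>a\<close> is read off the growth of \<open>norm (t - a)\<close> as \<open>t\<close> tends to infinity.
  Squares are positive, and an element that is bounded from both sides in this order is bounded in norm.
  Kaplansky's argument for \<open>h = c\<^sup>* c \<ge> 0\<close> (with \<open>norm h \<le> 1\<close>) uses the negative part of \<open>h\<close>; here the
  polynomials \<open>h (1 - h)\<^sup>2\<^sup>n\<close> take its place. They are \<open>\<le> 1\<close> and of the form \<open>w\<^sup>* w\<close>, hence also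
  \<open>\<ge> - 1\<close>, hence bounded in norm uniformly in \<open>n\<close>, and this forces \<open>norm (1 - h) \<le> 1\<close>.
\<close>

section \<open>Positivity in normed algebras with an adjoint relation\<close>

text \<open>If \<open>x = (1 + q) * K\<close> with \<open>q > 0\<close>, Bernoulli's inequality,
  squared, makes \<open>(1 + q) ^ m\<close> grow quadratically along \<open>m = 2 ^ k\<close>,
  faster than the linear factor allows. Together with \<open>sa_norm_power_two\<close>, this plays
  the part of the spectral radius formula.\<close>

lemma le_if_power_two_growth:
  fixes x K D :: real
  assumes "0 \<le> x" "0 < K" "0 \<le> D" and growth: "\<And>k. x ^ (2 ^ k) \<le> (1 + D * 2 ^ k) * K ^ (2 ^ k)"
  shows "x \<le> K"
proof (rule ccontr)
  assume "\<not> x \<le> K"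
  define q where "q = x / K - 1"
  have q: "q > 0" using \<open>\<not> x \<le> K\<close> \<open>0 < K\<close> by (simp add: q_def field_simps)
  have bound: "(1 + q) ^ (2 ^ k) \<le> 1 + D * 2 ^ k" for k
    using growth[of k] \<open>0 < K\<close> by (simp add: q_def power_divide field_simps)
  have lower: "(2 ^ k * q)\<^sup>2 \<le> (1 + q) ^ (2 ^ Suc k)" for k
  proof -
    have "1 + 2 ^ k * q \<le> (1 + q) ^ (2 ^ k)"
      using Bernoulli_inequality[of q "2 ^ k"] q by simp
    then have "(2 ^ k * q)\<^sup>2 \<le> ((1 + q) ^ (2 ^ k))\<^sup>2"
      using q by (intro power_mono) auto
    then show ?thesis by (simp add: power_mult[symmetric] mult.commute)
  qed
  have le: "2 ^ k * q\<^sup>2 \<le> 1 + 2 * D" for k :: nat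
  proof -
    have "(2 ^ k * q)\<^sup>2 \<le> 1 + D * 2 ^ Suc k"
      using lower[of k] bound[of "Suc k"] by linarith
    also have "\<dots> \<le> 2 ^ k * (1 + 2 * D)"
      by (simp add: algebra_simps)
    finally have "2 ^ k * (2 ^ k * q\<^sup>2) \<le> 2 ^ k * (1 + 2 * D)"
      by (simp add: power2_eq_square algebra_simps)
    then show ?thesis by simp
  qed
  obtain k where "(1 + 2 * D) / q\<^sup>2 < 2 ^ k"
    using real_arch_pow[of 2 "(1 + 2 * D) / q\<^sup>2"] by auto
  with le[of k] q show False by (simp add: field_simps)
qed

lemma diff_mult_add_commuting:
  fixes v y :: "'a::ring"
  assumes "v * y = y * v"
  shows "(y - v) * (y + v) = y * y - v * v"
  by (simp only: left_diff_distrib distrib_left assms) simp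

lemma eventually_at_top_divide:
  fixes r :: real
  assumes "eventually P at_top" "r > 0"
  shows "\<forall>\<^sub>F t in at_top. P (t / r)"
proof -
  obtain N where "\<And>t. t \<ge> N \<Longrightarrow> P t"
    using assms(1) by (auto simp: eventually_at_top_linorder)
  then have "P (t / r)" if "t \<ge> N * r" for t
    using that assms(2) by (simp add: pos_le_divide_eq)
  then show ?thesis by (auto simp: eventually_at_top_linorder)
qed

text \<open>A geometric sum whose ratio is an \<open>n\<close>-th root of unity. This orthogonality
  relation later isolates one coefficient of a polynomial.\<close>

lemma sum_root_unity_power:
  fixes n m :: nat
  assumes "n > 0"
  shows "(\<Sum>j<n. (exp (2 * of_real pi * \<i> * of_nat m / of_nat n) :: complex) ^ j)
    = (if n dvd m then of_nat n else 0)"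
proof -
  let ?r = "exp (2 * of_real pi * \<i> * of_nat m / of_nat n) :: complex"
  have one: "?r = 1 \<longleftrightarrow> n dvd m"
    using assms complex_root_unity_eq_1[of n m] by simp
  have "?r ^ n = 1"
    using assms complex_root_unity[of n m] by simp
  then show ?thesis
    using one geometric_sum[of ?r n] by auto
qed

text \<open>\<open>adjr a a'\<close> says that \<open>a'\<close> is an adjoint of \<open>a\<close>, and \<open>J\<close> is multiplication by the imaginary unit.
  Adjoints form a relation because not every bounded operator has one.\<close>

locale star_algebra =
  fixes adjr :: "'b::{real_normed_algebra,monoid_mult} \<Rightarrow> 'b \<Rightarrow> bool" and J :: 'b
  assumes norm_one_le: "norm (1::'b) \<le> 1"
    and adj_one: "adjr 1 1"
    and adj_add: "adjr a a' \<Longrightarrow> adjr b b' \<Longrightarrow> adjr (a + b) (a' + b')"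
    and adj_scaleR: "adjr a a' \<Longrightarrow> adjr (r *\<^sub>R a) (r *\<^sub>R a')"
    and adj_mult: "adjr a a' \<Longrightarrow> adjr b b' \<Longrightarrow> adjr (a * b) (b' * a')"
    and adj_sym: "adjr a a' \<Longrightarrow> adjr a' a"
    and norm_sq_le: "adjr a a' \<Longrightarrow> (norm a)\<^sup>2 \<le> norm (a' * a)"
    and J_square: "J * J = - 1"
    and J_adj: "adjr J (- J)"
    and J_central: "adjr a a' \<Longrightarrow> J * a = a * J"
begin

abbreviation sa :: "'b \<Rightarrow> bool" where "sa a \<equiv> adjr a a"

lemma adj_minus: "adjr a a' \<Longrightarrow> adjr (- a) (- a')"
  using adj_scaleR[of a a' "-1"] by simp

lemma adj_diff: "adjr a a' \<Longrightarrow> adjr b b' \<Longrightarrow> adjr (a - b) (a' - b')"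
  using adj_add[OF _ adj_minus] by fastforce

lemma sa_power: "sa a \<Longrightarrow> sa (a ^ n)"
proof (induction n)
  case (Suc n)
  then have "adjr (a * a ^ n) (a ^ n * a)" by (intro adj_mult)
  then show ?case by (simp add: power_commutes)
qed (simp add: adj_one)

lemma sa_scaleR_one: "sa (r *\<^sub>R 1)"
  by (intro adj_scaleR adj_one)

lemma sa_mult: "sa a \<Longrightarrow> sa b \<Longrightarrow> a * b = b * a \<Longrightarrow> sa (a * b)"
  using adj_mult by metis

lemma norm_scaleR_one: "norm (r *\<^sub>R (1::'b)) \<le> \<bar>r\<bar>"
  using mult_left_mono[OF norm_one_le, of "\<bar>r\<bar>"] by simp

lemma norm_scaleR_one_add: "norm (r *\<^sub>R 1 + (a::'b)) \<le> \<bar>r\<bar> + norm a"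
  using norm_triangle_ineq[of "r *\<^sub>R 1" a] norm_scaleR_one[of r] by linarith

lemma norm_power_le: "norm ((a::'b) ^ n) \<le> norm a ^ n"
proof (induction n)
  case (Suc n)
  then show ?case
    using norm_mult_ineq[of a "a ^ n"] mult_left_mono[OF Suc, of "norm a"] by simp
qed (simp add: norm_one_le)

text \<open>The inequality \<open>norm_sq_le\<close> is iterated along repeated squaring. Only
  exponents \<open>2 ^ k\<close> are reached, so growth bounds on powers are evaluated
  there.\<close>

lemma sa_norm_power_two: "sa a \<Longrightarrow> norm (a ^ (2 ^ k)) = norm a ^ (2 ^ k)"
proof (induction k)
  case (Suc k)
  let ?b = "a ^ (2 ^ k)"
  have "(norm ?b)\<^sup>2 \<le> norm (?b * ?b)" using Suc.prems by (intro norm_sq_le sa_power)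
  moreover have "norm (?b * ?b) \<le> (norm ?b)\<^sup>2"
    by (simp add: power2_eq_square norm_mult_ineq)
  ultimately have "norm (?b * ?b) = (norm ?b)\<^sup>2" by (intro antisym)
  moreover have "?b * ?b = a ^ (2 ^ Suc k)"
    by (simp only: power_add[symmetric] mult_2[symmetric] power_Suc)
  moreover have "(norm a ^ (2 ^ k))\<^sup>2 = norm a ^ (2 ^ Suc k)"
    by (simp only: power_mult[symmetric] power_Suc mult.commute)
  ultimately show ?case using Suc by simp
qed simp

lemma J_mult_adj:
  assumes "sa x"
  shows "adjr (J * x) (- (J * x))"
  using adj_mult[OF J_adj assms] J_central[OF assms] by simp

lemma J_mult_square:
  assumes "sa x"
  shows "(J * x) * (J * x) = - (x * x)"
proof -
  have Jx: "J * x = x * J" using assms by (rule J_central)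
  have "(J * x) * (J * x) = J * (x * J) * x" by (simp only: mult.assoc)
  also have "\<dots> = (J * J) * (x * x)" by (simp only: Jx[symmetric] mult.assoc)
  finally show ?thesis by (simp add: J_square)
qed

section \<open>The cone of nonnegative elements\<close>

text \<open>For self-adjoint elements this is positivity: the limit of \<open>norm (t - a) - t\<close> as
  \<open>t\<close> tends to infinity is the maximum of the numerical range of \<open>- a\<close>. Unlike spectral
  positivity it is visibly a closed convex cone.\<close>

definition nneg :: "'b \<Rightarrow> bool" where
  "nneg a \<longleftrightarrow> (\<forall>e>0. \<forall>\<^sub>F t in at_top. norm (t *\<^sub>R 1 - a) \<le> t + e)"

lemma nneg_zero: "nneg 0"
proof -
  have "\<forall>\<^sub>F t in at_top. norm (t *\<^sub>R (1::'b)) \<le> t + e" if "e > 0" for e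
    using eventually_ge_at_top[of "0::real"]
  proof eventually_elim
    case (elim t)
    then show ?case using norm_scaleR_one[of t] that by simp
  qed
  then show ?thesis by (simp add: nneg_def)
qed

lemma nneg_scaleR:
  assumes "nneg a" "0 \<le> r"
  shows "nneg (r *\<^sub>R a)"
proof (cases "r = 0")
  case True
  then show ?thesis by (simp add: nneg_zero)
next
  case False
  then have r: "r > 0" using assms by simp
  show ?thesis unfolding nneg_def
  proof (intro allI impI)
    fix e :: real assume "e > 0"
    then have "\<forall>\<^sub>F t in at_top. norm (t *\<^sub>R 1 - a) \<le> t + e / r"
      using assms r by (auto simp: nneg_def)
    then have "\<forall>\<^sub>F t in at_top. norm ((t / r) *\<^sub>R 1 - a) \<le> t / r + e / r"
      using r by (rule eventually_at_top_divide)
    then show "\<forall>\<^sub>F t in at_top. norm (t *\<^sub>R 1 - r *\<^sub>R a) \<le> t + e"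
    proof eventually_elim
      case (elim t)
      have "t *\<^sub>R 1 - r *\<^sub>R a = r *\<^sub>R ((t / r) *\<^sub>R 1 - a)"
        using r by (simp add: scaleR_diff_right)
      then have "norm (t *\<^sub>R 1 - r *\<^sub>R a) = r * norm ((t / r) *\<^sub>R 1 - a)"
        using r by simp
      also have "\<dots> \<le> r * (t / r + e / r)" using elim r by (intro mult_left_mono) auto
      also have "\<dots> = t + e" using r by (simp add: field_simps)
      finally show ?case .
    qed
  qed
qed

lemma nneg_add:
  assumes "nneg a" "nneg b"
  shows "nneg (a + b)"
  unfolding nneg_def
proof (intro allI impI)
  fix e :: real assume "e > 0"
  then have "\<forall>\<^sub>F t in at_top. norm (t *\<^sub>R 1 - a) \<le> t + e / 2 \<and> norm (t *\<^sub>R 1 - b) \<le> t + e / 2"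
    using assms by (intro eventually_conj) (auto simp: nneg_def)
  then have "\<forall>\<^sub>F t in at_top. norm ((t / 2) *\<^sub>R 1 - a) \<le> t / 2 + e / 2 \<and> norm ((t / 2) *\<^sub>R 1 - b) \<le> t / 2 + e / 2"
    by (rule eventually_at_top_divide) simp
  then show "\<forall>\<^sub>F t in at_top. norm (t *\<^sub>R 1 - (a + b)) \<le> t + e"
  proof eventually_elim
    case (elim t)
    have eq: "t *\<^sub>R 1 - (a + b) = ((t / 2) *\<^sub>R 1 - a) + ((t / 2) *\<^sub>R 1 - b)"
      using scaleR_add_left[of "t/2" "t/2" "1::'b"] by simp
    show ?case unfolding eq
      using elim norm_triangle_ineq[of "(t / 2) *\<^sub>R 1 - a" "(t / 2) *\<^sub>R 1 - b"] by linarith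
  qed
qed

lemma nneg_sum: "(\<And>i. i \<in> I \<Longrightarrow> nneg (f i)) \<Longrightarrow> nneg (sum f I)"
  by (induction I rule: infinite_finite_induct) (auto simp: nneg_zero intro: nneg_add)

lemma nneg_norm_le:
  assumes "norm a \<le> d"
  shows "nneg (d *\<^sub>R 1 - a)"
  unfolding nneg_def
proof (intro allI impI)
  fix e :: real assume "e > 0"
  show "\<forall>\<^sub>F t in at_top. norm (t *\<^sub>R 1 - (d *\<^sub>R 1 - a)) \<le> t + e"
    using eventually_ge_at_top[of d]
  proof eventually_elim
    case (elim t)
    have eq: "t *\<^sub>R 1 - (d *\<^sub>R 1 - a) = (t - d) *\<^sub>R 1 + a" by (simp add: scaleR_diff_left)
    show ?case unfolding eq
      using norm_scaleR_one_add[of "t - d" a] assms elim \<open>e > 0\<close> by linarith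
  qed
qed

lemma nneg_closed:
  assumes "\<And>d. d > 0 \<Longrightarrow> nneg (d *\<^sub>R 1 + a)"
  shows "nneg a"
  unfolding nneg_def
proof (intro allI impI)
  fix e :: real assume "e > 0"
  then have "\<forall>\<^sub>F t in at_top. norm (t *\<^sub>R 1 - ((e/2) *\<^sub>R 1 + a)) \<le> t + e / 2"
    using assms[of "e/2"] by (auto simp: nneg_def)
  then show "\<forall>\<^sub>F t in at_top. norm (t *\<^sub>R 1 - a) \<le> t + e"
  proof eventually_elim
    case (elim t)
    have eq: "t *\<^sub>R 1 - a = (e/2) *\<^sub>R 1 + (t *\<^sub>R 1 - ((e/2) *\<^sub>R 1 + a))" by simp
    show ?case
      using elim norm_scaleR_one_add[of "e/2" "t *\<^sub>R 1 - ((e/2) *\<^sub>R 1 + a)"] \<open>e > 0\<close>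
      unfolding eq[symmetric] by linarith
  qed
qed

text \<open>\<open>1 + i s x - s\<^sup>2 x\<^sup>2 / 2\<close> is unitary up to \<open>O(s\<^sup>4)\<close>, and its real part is
  \<open>1 - s\<^sup>2 x\<^sup>2 / 2\<close>. Below, \<open>t = 2 / s\<^sup>2\<close> and everything is multiplied by \<open>t\<close>.\<close>

lemma nneg_square:
  assumes "sa x"
  shows "nneg (x * x)"
  unfolding nneg_def
proof (intro allI impI)
  fix e :: real assume e: "e > 0"
  let ?c = "norm (x * x * (x * x))"
  have "\<forall>\<^sub>F t in at_top. t > 0 \<and> ?c \<le> 2 * t * e"
    using eventually_ge_at_top[of "max 1 (?c / (2 * e))"]
    by eventually_elim (use e in \<open>auto simp: field_simps\<close>)
  then show "\<forall>\<^sub>F t in at_top. norm (t *\<^sub>R 1 - x * x) \<le> t + e"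
  proof eventually_elim
    case (elim t)
    \<comment> \<open>With this \<open>r\<close> the terms in \<open>x * x\<close> cancel in
      \<open>y * y - v * v\<close>, which leaves \<open>t * t\<close> plus the fourth power of
      \<open>x\<close>.\<close>
    define r where "r = sqrt (2 * t)"
    have rr: "r * r = 2 * t" using elim by (simp add: r_def)
    define y where "y = t *\<^sub>R 1 - x * x"
    define v where "v = r *\<^sub>R (J * x)"
    have y_sa: "sa y" unfolding y_def using assms by (intro adj_diff sa_scaleR_one adj_mult)
    have v_adj: "adjr v (- v)"
      unfolding v_def using adj_scaleR[OF J_mult_adj[OF assms], of r] by simp
    have adj: "adjr (y + v) (y - v)" using adj_add[OF y_sa v_adj] by simp
    have "x * y = y * x" by (simp add: y_def right_diff_distrib left_diff_distrib mult.assoc)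
    then have "(J * x) * y = y * (J * x)"
      using J_central[OF y_sa] by (simp only: mult.assoc) (simp only: mult.assoc[symmetric])
    then have comm: "v * y = y * v" by (simp add: v_def)
    have vv: "v * v = - ((2 * t) *\<^sub>R (x * x))"
      unfolding v_def mult_scaleR_left mult_scaleR_right J_mult_square[OF assms] scaleR_scaleR rr by simp
    have "(y - v) * (y + v) = y * y - v * v"
      using comm by (rule diff_mult_add_commuting)
    also have "\<dots> = (t * t) *\<^sub>R 1 + x * x * (x * x)"
      unfolding vv y_def using scaleR_add_left[of t t "x * x"]
      by (simp add: right_diff_distrib left_diff_distrib scaleR_diff_right)
    finally have uu: "(y - v) * (y + v) = (t * t) *\<^sub>R 1 + x * x * (x * x)" .
    moreover have "(y + v) * (y - v) = (y - v) * (y + v)"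
      using diff_mult_add_commuting[OF comm] diff_mult_add_commuting[of "- v" y] comm by simp
    ultimately have n: "norm ((y - v) * (y + v)) \<le> t * t + ?c" "norm ((y + v) * (y - v)) \<le> t * t + ?c"
      using norm_scaleR_one_add[of "t * t" "x * x * (x * x)"] by auto
    have "(t + e)\<^sup>2 = t * t + 2 * t * e + e\<^sup>2" by (simp add: power2_eq_square algebra_simps)
    then have sq: "t * t + ?c \<le> (t + e)\<^sup>2" using elim zero_le_power2[of e] by linarith
    have "norm (y + v) \<le> t + e"
      by (rule power2_le_imp_le) (use norm_sq_le[OF adj] n(1) sq elim e in linarith)+
    moreover have "norm (y - v) \<le> t + e"
      by (rule power2_le_imp_le) (use norm_sq_le[OF adj_sym[OF adj]] n(2) sq elim e in linarith)+
    moreover have "norm (2 *\<^sub>R y) \<le> norm (y + v) + norm (y - v)"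
      using norm_triangle_ineq[of "y + v" "y - v"] by (simp add: scaleR_2)
    ultimately show ?case by (simp add: y_def)
  qed
qed

text \<open>The identity \<open>2 (1 - h) = (1 - h)\<^sup>2 + (1 - h\<^sup>2)\<close> is iterated, replacing \<open>h\<close> by \<open>h\<^sup>2\<close>;
  this takes the place of a square root of \<open>1 - h\<close>.\<close>

lemma nneg_compress:
  assumes "sa h" "norm h \<le> 1" "sa x" "x * h = h * x"
  shows "nneg (x * (1 - h) * x)"
proof -
  \<comment> \<open>\<open>c\<close> bounds the norm of \<open>x * (1 - h) * x\<close> whenever
    \<open>norm h \<le> 1\<close>. It is the error before the first use of the identity, and each
    further use halves the error.\<close>
  define c where "c = 2 * (norm x * norm x)"
  have approx: "nneg ((c / 2 ^ k) *\<^sub>R 1 + x * (1 - h) * x)"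
    if "sa h" "norm h \<le> 1" "x * h = h * x" for k h
    using that
  proof (induction k arbitrary: h)
    case 0
    have "norm (1 - h) \<le> 2"
      using norm_triangle_ineq4[of 1 h] norm_one_le 0 by linarith
    then have "norm x * norm (1 - h) * norm x \<le> norm x * 2 * norm x"
      by (intro mult_mono) auto
    moreover have "norm (x * (1 - h) * x) \<le> norm x * norm (1 - h) * norm x"
      by (rule order_trans[OF norm_mult_ineq]) (intro mult_right_mono norm_mult_ineq norm_ge_zero)
    ultimately have "norm (- (x * (1 - h) * x)) \<le> c" by (simp add: c_def)
    from nneg_norm_le[OF this] show ?case by simp
  next
    case (Suc k)
    let ?y = "(1 - h) * x"
    have comm: "(1 - h) * x = x * (1 - h)"
      using Suc.prems by (simp add: left_diff_distrib right_diff_distrib)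
    have "x * (h * h) = (h * h) * x"
      using Suc.prems(3) by (metis mult.assoc)
    moreover have "norm (h * h) \<le> 1"
      using norm_mult_ineq[of h h] Suc.prems(2) by (meson mult_le_one norm_ge_zero order_trans)
    moreover have "sa (h * h)" using Suc.prems by (intro adj_mult)
    ultimately have "nneg ((c / 2 ^ k) *\<^sub>R 1 + x * (1 - h * h) * x)"
      by (intro Suc.IH)
    moreover have "nneg (?y * ?y)"
      using Suc.prems assms comm by (intro nneg_square sa_mult adj_diff adj_one)
    ultimately have "nneg ((1/2) *\<^sub>R (((c / 2 ^ k) *\<^sub>R 1 + x * (1 - h * h) * x) + ?y * ?y))"
      by (rule nneg_scaleR[OF nneg_add]) simp
    also have "?y * ?y = x * ((1 - h) * (1 - h)) * x"
      by (subst comm) (simp only: mult.assoc)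
    also have "((c / 2 ^ k) *\<^sub>R 1 + x * (1 - h * h) * x) + x * ((1 - h) * (1 - h)) * x
      = (c / 2 ^ k) *\<^sub>R 1 + x * ((1 - h * h) + (1 - h) * (1 - h)) * x"
      by (simp only: distrib_left distrib_right add.assoc)
    also have "(1 - h * h) + (1 - h) * (1 - h) = 2 *\<^sub>R (1 - h)"
      by (simp add: left_diff_distrib right_diff_distrib scaleR_2)
    finally show ?case by (simp add: scaleR_add_right)
  qed
  show ?thesis
  proof (rule nneg_closed)
    fix d :: real assume "d > 0"
    obtain k where "c / d < 2 ^ k" using real_arch_pow[of 2 "c / d"] by auto
    then have "c / 2 ^ k \<le> d" using \<open>d > 0\<close> by (simp add: field_simps)
    then have "nneg ((d - c / 2 ^ k) *\<^sub>R 1 - 0)" by (intro nneg_norm_le) simp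
    from nneg_add[OF this approx[OF assms(1,2,4), of k]]
    show "nneg (d *\<^sub>R 1 + x * (1 - h) * x)" by (simp add: scaleR_diff_left)
  qed
qed

section \<open>Complex scalars and the bound of the norm by the numerical range\<close>

definition cplx :: "complex \<Rightarrow> 'b" where
  "cplx z = Re z *\<^sub>R 1 + Im z *\<^sub>R J"

lemma cplx_mult: "cplx (z * w) = cplx z * cplx w"
  by (simp add: cplx_def distrib_left distrib_right J_square scaleR_add_left scaleR_diff_left algebra_simps)

lemma cplx_of_real: "cplx (of_real r) = r *\<^sub>R 1"
  by (simp add: cplx_def)

lemma cplx_0: "cplx 0 = 0"
  by (simp add: cplx_def)

lemma cplx_1: "cplx 1 = 1"
  by (simp add: cplx_def)

lemma cplx_sum: "cplx (sum f I) = (\<Sum>i\<in>I. cplx (f i))"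
  by (simp add: cplx_def scaleR_sum_left sum.distrib)

lemma cplx_commute: "adjr a a' \<Longrightarrow> cplx z * a = a * cplx z"
  by (simp add: cplx_def distrib_left distrib_right J_central)

lemma norm_cplx_le: "norm (cplx z) \<le> cmod z"
proof (rule power2_le_imp_le)
  have "adjr (cplx z) (cplx (cnj z))"
    using adj_add[OF sa_scaleR_one adj_scaleR[OF J_adj], of "Re z" "Im z"] by (simp add: cplx_def)
  from norm_sq_le[OF this] have "(norm (cplx z))\<^sup>2 \<le> norm (cplx (of_real ((cmod z)\<^sup>2)))"
    by (simp only: cplx_mult[symmetric] complex_norm_square mult.commute)
  then show "(norm (cplx z))\<^sup>2 \<le> (cmod z)\<^sup>2"
    using norm_scaleR_one[of "(cmod z)\<^sup>2"] by (simp only: cplx_of_real) (simp only: abs_power2)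
qed simp

text \<open>A binomial expansion whose coefficients do not depend on \<open>z\<close>, because
  \<open>cplx z\<close> commutes with \<open>g\<close>. The value of \<open>c 0\<close> and the
  vanishing above \<open>n\<close> are there for the induction: the new linear coefficient is
  \<open>t *\<^sub>R c 1 + g * c 0\<close>, and the sum is extended by one index.\<close>

lemma power_expansion:
  assumes "sa g"
  shows "\<exists>c. c 0 = t ^ n *\<^sub>R 1 \<and> c 1 = (n * t ^ (n - 1)) *\<^sub>R g \<and> (\<forall>k>n. c k = 0) \<and>
    (\<forall>z. (t *\<^sub>R 1 + cplx z * g) ^ n = (\<Sum>k\<le>n. cplx (z ^ k) * c k))"
proof (induction n)
  case 0
  show ?case by (intro exI[of _ "\<lambda>k. if k = 0 then 1 else 0"]) (simp add: cplx_1)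
next
  case (Suc n)
  then obtain c where c: "c 0 = t ^ n *\<^sub>R 1" "c 1 = (n * t ^ (n - 1)) *\<^sub>R g" "\<And>k. k > n \<Longrightarrow> c k = 0"
    and pow: "\<And>z. (t *\<^sub>R 1 + cplx z * g) ^ n = (\<Sum>k\<le>n. cplx (z ^ k) * c k)" by blast
  define d where "d = (\<lambda>k. t *\<^sub>R c k + (case k of 0 \<Rightarrow> 0 | Suc j \<Rightarrow> g * c j))"
  have "(t *\<^sub>R 1 + cplx z * g) ^ Suc n = (\<Sum>k\<le>Suc n. cplx (z ^ k) * d k)" for z
  proof -
    have "(t *\<^sub>R 1 + cplx z * g) ^ Suc n
      = (\<Sum>k\<le>n. t *\<^sub>R (cplx (z ^ k) * c k)) + (\<Sum>k\<le>n. cplx z * g * (cplx (z ^ k) * c k))"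
      by (simp add: pow distrib_right scaleR_sum_right sum_distrib_left sum.distrib)
    also have "(\<Sum>k\<le>n. cplx z * g * (cplx (z ^ k) * c k)) = (\<Sum>k\<le>n. cplx (z ^ Suc k) * (g * c k))"
    proof (rule sum.cong[OF refl])
      fix k
      have "cplx z * g * (cplx (z ^ k) * c k) = cplx z * (g * cplx (z ^ k)) * c k"
        by (simp only: mult.assoc)
      also have "\<dots> = cplx (z ^ Suc k) * (g * c k)"
        by (simp only: cplx_commute[OF assms, symmetric] power_Suc cplx_mult mult.assoc)
      finally show "cplx z * g * (cplx (z ^ k) * c k) = cplx (z ^ Suc k) * (g * c k)" .
    qed
    also have "(\<Sum>k\<le>n. t *\<^sub>R (cplx (z ^ k) * c k)) = (\<Sum>k\<le>Suc n. cplx (z ^ k) * (t *\<^sub>R c k))"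
      by (simp add: c(3))
    also have "(\<Sum>k\<le>n. cplx (z ^ Suc k) * (g * c k))
      = (\<Sum>k\<le>Suc n. cplx (z ^ k) * (case k of 0 \<Rightarrow> 0 | Suc j \<Rightarrow> g * c j))"
      by (subst sum.atMost_Suc_shift) simp
    finally show ?thesis by (simp only: d_def distrib_left sum.distrib)
  qed
  moreover have "d 1 = (Suc n * t ^ (Suc n - 1)) *\<^sub>R g"
  proof -
    have "d 1 = (t * (n * t ^ (n - 1)) + t ^ n) *\<^sub>R g"
      using c(1,2) by (simp add: d_def scaleR_add_left)
    also have "t * (n * t ^ (n - 1)) + t ^ n = Suc n * t ^ (Suc n - 1)"
      by (cases n) (simp_all add: algebra_simps)
    finally show ?thesis .
  qed
  moreover have "d 0 = t ^ Suc n *\<^sub>R 1" "\<And>k. k > Suc n \<Longrightarrow> d k = 0"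
    using c by (auto simp: d_def split: nat.split)
  ultimately show ?case by blast
qed

text \<open>Cauchy's estimate, with the integral over the circle replaced by the average over the
  \<open>n\<close>-th roots of unity. The weight \<open>r j ^ (n - 1)\<close> is the inverse of the
  root \<open>r j\<close> and so selects the coefficient of index 1.\<close>

lemma norm_linear_coeff_le:
  assumes "n \<ge> 2" and bound: "\<And>z. cmod z = 1 \<Longrightarrow> norm (\<Sum>k\<le>n. cplx (z ^ k) * c k) \<le> K"
  shows "norm (c 1) \<le> K"
proof -
  define r where "r = (\<lambda>m. exp (2 * of_real pi * \<i> * of_nat m / of_nat n) :: complex)"
  have r_power: "r m = r 1 ^ m" for m
    by (simp add: r_def exp_of_nat_mult[symmetric] algebra_simps)
  have unit: "cmod (r m) = 1" for m
    by (simp add: r_def norm_exp_eq_Re)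
  define S where "S = (\<Sum>j<n. cplx (r j ^ (n - 1)) * (\<Sum>k\<le>n. cplx (r j ^ k) * c k))"
  have "S = (\<Sum>j<n. \<Sum>k\<le>n. cplx (r (k + (n - 1)) ^ j) * c k)"
    unfolding S_def
  proof (rule sum.cong[OF refl])
    fix j
    have "r j ^ (n - 1) * r j ^ k = r (k + (n - 1)) ^ j" for k
      unfolding r_power[of j] r_power[of "k + (n - 1)"]
      by (simp only: power_mult[symmetric] power_add[symmetric]) (simp add: algebra_simps)
    then show "cplx (r j ^ (n - 1)) * (\<Sum>k\<le>n. cplx (r j ^ k) * c k)
      = (\<Sum>k\<le>n. cplx (r (k + (n - 1)) ^ j) * c k)"
      by (simp only: sum_distrib_left mult.assoc[symmetric] cplx_mult[symmetric])
  qed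
  also have "\<dots> = (\<Sum>k\<le>n. cplx (\<Sum>j<n. r (k + (n - 1)) ^ j) * c k)"
    by (subst sum.swap) (simp only: cplx_sum sum_distrib_right)
  also have "\<dots> = (\<Sum>k\<le>n. if k = 1 then n *\<^sub>R c k else 0)"
  proof (rule sum.cong[OF refl])
    fix k assume "k \<in> {..n}"
    \<comment> \<open>Since \<open>k + (n - 1) \<le> 2 * n - 1\<close>, the only positive multiple
      of \<open>n\<close> available is \<open>n\<close> itself; \<open>n \<ge> 2\<close> excludes
      the value 0.\<close>
    have "n dvd k + (n - 1) \<longleftrightarrow> k = 1"
    proof
      assume "n dvd k + (n - 1)"
      then obtain q where q: "k + (n - 1) = n * q" by (auto simp: dvd_def)
      have "q > 0" using q assms(1) by (cases q) auto
      moreover have "n * q < n * 2" using \<open>k \<in> {..n}\<close> assms(1) unfolding q[symmetric] by simp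
      ultimately have "q = 1" by simp
      then show "k = 1" using q assms(1) by simp
    qed (use assms in auto)
    moreover have "n > 0" using assms(1) by simp
    ultimately have "(\<Sum>j<n. r (k + (n - 1)) ^ j) = (if k = 1 then of_real (real n) else 0)"
      unfolding r_def by (subst sum_root_unity_power) auto
    then show "cplx (\<Sum>j<n. r (k + (n - 1)) ^ j) * c k = (if k = 1 then n *\<^sub>R c k else 0)"
      by (simp only: cplx_of_real cplx_0 if_distrib[of cplx]) simp
  qed
  also have "\<dots> = n *\<^sub>R c 1" using assms(1) by simp
  finally have "real n * norm (c 1) = norm S" by simp
  also have "\<dots> \<le> (\<Sum>j<n. K)"
    unfolding S_def
  proof (rule sum_norm_le)
    fix j
    have "norm (cplx (r j ^ (n - 1))) \<le> 1"
      using norm_cplx_le[of "r j ^ (n - 1)"] unit[of j] by (simp add: norm_power)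
    then have "norm (cplx (r j ^ (n - 1))) * norm (\<Sum>k\<le>n. cplx (r j ^ k) * c k) \<le> 1 * K"
      using bound[OF unit[of j]] by (intro mult_mono) auto
    then show "norm (cplx (r j ^ (n - 1)) * (\<Sum>k\<le>n. cplx (r j ^ k) * c k)) \<le> K"
      using norm_mult_ineq order_trans by fastforce
  qed
  finally show ?thesis using assms(1) by simp
qed

text \<open>The numerical range controls the norm. On the circle of radius \<open>1\<close> around \<open>0\<close>,
  \<open>norm (n + z g) \<le> n + 4\<close> for large \<open>n\<close>, so Cauchy's estimate for the linear
  coefficient of \<open>(n + z g)\<^sup>n\<close> gives \<open>n\<^sup>n norm g \<le> (n + 4)\<^sup>n\<close>.\<close>

lemma norm_le_exp_if_nneg:
  assumes "sa g" "nneg (1 - g)" "nneg (1 + g)"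
  shows "norm g \<le> exp 4"
proof -
  have "\<forall>\<^sub>F t in at_top. norm (t *\<^sub>R 1 - (1 - g)) \<le> t + 1 \<and> norm (t *\<^sub>R 1 - (1 + g)) \<le> t + 1"
    using assms(2,3) by (intro eventually_conj) (auto simp: nneg_def)
  then obtain N where N: "\<And>t. t \<ge> N \<Longrightarrow> norm (t *\<^sub>R 1 - (1 - g)) \<le> t + 1 \<and> norm (t *\<^sub>R 1 - (1 + g)) \<le> t + 1"
    by (auto simp: eventually_at_top_linorder)
  \<comment> \<open>\<open>n\<close> is split into two halves \<open>s\<close>, one for the real and
    one for the imaginary part of \<open>z\<close>. The bound
    \<open>s \<ge> (norm g)\<^sup>2\<close> lets \<open>(s + 2)\<^sup>2\<close> absorb the square of
    \<open>g\<close> in the imaginary part.\<close>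
  obtain n :: nat where n: "n \<ge> 2 * max N (max 1 ((norm g)\<^sup>2))"
    using real_arch_simple by blast
  define s where "s = real n / 2"
  have s: "s \<ge> N" "s \<ge> 1" "s \<ge> (norm g)\<^sup>2" using n by (auto simp: s_def)
  have "norm (s *\<^sub>R 1 + g) \<le> s + 2"
  proof -
    have "s *\<^sub>R 1 + g = 1 *\<^sub>R 1 + (s *\<^sub>R 1 - (1 - g))" by simp
    then show ?thesis
      using norm_scaleR_one_add[of 1 "s *\<^sub>R 1 - (1 - g)"] N[OF s(1)] by (simp only:) linarith
  qed
  moreover have "norm (s *\<^sub>R 1 - g) \<le> s + 2"
  proof -
    have "s *\<^sub>R 1 - g = 1 *\<^sub>R 1 + (s *\<^sub>R 1 - (1 + g))" by simp
    then show ?thesis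
      using norm_scaleR_one_add[of 1 "s *\<^sub>R 1 - (1 + g)"] N[OF s(1)] by (simp only:) linarith
  qed
  ultimately have re: "norm (s *\<^sub>R 1 + \<alpha> *\<^sub>R g) \<le> s + 2" if "\<bar>\<alpha>\<bar> \<le> 1" for \<alpha>
  proof -
    have "s *\<^sub>R 1 + \<alpha> *\<^sub>R g = ((1 + \<alpha>) / 2) *\<^sub>R (s *\<^sub>R 1 + g) + ((1 - \<alpha>) / 2) *\<^sub>R (s *\<^sub>R 1 - g)"
    proof -
      have "s *\<^sub>R 1 + \<alpha> *\<^sub>R g
        = ((1 + \<alpha>) / 2 + (1 - \<alpha>) / 2) *\<^sub>R (s *\<^sub>R 1) + ((1 + \<alpha>) / 2 - (1 - \<alpha>) / 2) *\<^sub>R g"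
        by (simp add: add_divide_distrib[symmetric] diff_divide_distrib[symmetric])
      then show ?thesis
        by (simp only: scaleR_add_left scaleR_diff_left scaleR_add_right scaleR_diff_right) simp
    qed
    then have "norm (s *\<^sub>R 1 + \<alpha> *\<^sub>R g)
      \<le> (1 + \<alpha>) / 2 * norm (s *\<^sub>R 1 + g) + (1 - \<alpha>) / 2 * norm (s *\<^sub>R 1 - g)"
      using that norm_triangle_ineq[of "((1 + \<alpha>) / 2) *\<^sub>R (s *\<^sub>R 1 + g)" "((1 - \<alpha>) / 2) *\<^sub>R (s *\<^sub>R 1 - g)"]
      by simp
    also have "\<dots> \<le> (1 + \<alpha>) / 2 * (s + 2) + (1 - \<alpha>) / 2 * (s + 2)"
      using that \<open>norm (s *\<^sub>R 1 + g) \<le> s + 2\<close> \<open>norm (s *\<^sub>R 1 - g) \<le> s + 2\<close>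
      by (intro add_mono mult_left_mono) auto
    finally show ?thesis by (simp add: field_simps)
  qed
  have im: "norm (s *\<^sub>R 1 + \<beta> *\<^sub>R (J * g)) \<le> s + 2" if "\<bar>\<beta>\<bar> \<le> 1" for \<beta>
  proof (rule power2_le_imp_le)
    define v where "v = \<beta> *\<^sub>R (J * g)"
    have "adjr v (- v)"
      unfolding v_def using adj_scaleR[OF J_mult_adj[OF assms(1)], of \<beta>] by simp
    then have adj: "adjr (s *\<^sub>R 1 + v) (s *\<^sub>R 1 - v)"
      using adj_add[OF sa_scaleR_one] by fastforce
    have vv: "v * v = - ((\<beta> * \<beta>) *\<^sub>R (g * g))"
      by (simp add: v_def J_mult_square[OF assms(1)])
    have "(s *\<^sub>R 1 - v) * (s *\<^sub>R 1 + v) = (s * s) *\<^sub>R 1 + (\<beta> * \<beta>) *\<^sub>R (g * g)"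
      by (subst diff_mult_add_commuting) (simp_all add: vv)
    then have "(norm (s *\<^sub>R 1 + v))\<^sup>2 \<le> norm ((s * s) *\<^sub>R 1 + (\<beta> * \<beta>) *\<^sub>R (g * g))"
      using norm_sq_le[OF adj] by simp
    also have "\<dots> \<le> s * s + norm ((\<beta> * \<beta>) *\<^sub>R (g * g))"
      using norm_scaleR_one_add[of "s * s" "(\<beta> * \<beta>) *\<^sub>R (g * g)"] by simp
    also have "norm ((\<beta> * \<beta>) *\<^sub>R (g * g)) \<le> 1 * (norm g)\<^sup>2"
      unfolding norm_scaleR
      using mult_le_one[OF that _ that] norm_mult_ineq[of g g]
      by (intro mult_mono) (auto simp: power2_eq_square abs_mult)
    also have "s * s + 1 * (norm g)\<^sup>2 \<le> (s + 2)\<^sup>2"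
      using s by (simp add: power2_eq_square algebra_simps)
    finally show "(norm (s *\<^sub>R 1 + \<beta> *\<^sub>R (J * g)))\<^sup>2 \<le> (s + 2)\<^sup>2" by (simp add: v_def)
  qed (use s in simp)
  have disc: "norm (real n *\<^sub>R 1 + cplx z * g) \<le> n + 4" if "cmod z = 1" for z
  proof -
    have "\<bar>Re z\<bar> \<le> 1" "\<bar>Im z\<bar> \<le> 1"
      using abs_Re_le_cmod[of z] abs_Im_le_cmod[of z] that by auto
    moreover have "real n *\<^sub>R 1 + cplx z * g = (s *\<^sub>R 1 + Re z *\<^sub>R g) + (s *\<^sub>R 1 + Im z *\<^sub>R (J * g))"
      using scaleR_add_left[of s s "1::'b"] by (simp add: cplx_def s_def distrib_right)
    ultimately show ?thesis
      using re[of "Re z"] im[of "Im z"]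
        norm_triangle_ineq[of "s *\<^sub>R 1 + Re z *\<^sub>R g" "s *\<^sub>R 1 + Im z *\<^sub>R (J * g)"]
      by (simp add: s_def)
  qed
  obtain c where c: "c 1 = (n * real n ^ (n - 1)) *\<^sub>R g"
    and pow: "\<And>z. (real n *\<^sub>R 1 + cplx z * g) ^ n = (\<Sum>k\<le>n. cplx (z ^ k) * c k)"
    using power_expansion[OF assms(1), of "real n" n] by blast
  have n2: "n \<ge> 2" using n by linarith
  have "norm (c 1) \<le> (n + 4) ^ n"
  proof (rule norm_linear_coeff_le[OF n2])
    fix z :: complex assume "cmod z = 1"
    then show "norm (\<Sum>k\<le>n. cplx (z ^ k) * c k) \<le> (n + 4) ^ n"
      unfolding pow[symmetric]
      using order_trans[OF norm_power_le power_mono[OF disc norm_ge_zero]] by simp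
  qed
  moreover have "norm (c 1) = real n ^ n * norm g"
    unfolding c using n2 power_minus_mult[of n "real n"] by (simp add: mult.commute)
  ultimately have "norm g \<le> real (n + 4) ^ n / real n ^ n"
    using n2 by (simp add: pos_le_divide_eq mult.commute)
  also have "\<dots> = (1 + 4 / real n) ^ n"
    unfolding power_divide[symmetric] using n2 by (simp add: add_divide_distrib)
  also have "\<dots> \<le> exp (4 / real n) ^ n"
    by (intro power_mono exp_ge_add_one_self) simp
  also have "\<dots> = exp 4" using n2 by (simp add: exp_of_nat_mult[symmetric])
  finally show ?thesis .
qed

section \<open>Nonnegativity of products of an adjoint with its element\<close>

text \<open>The norm of \<open>s + w w'\<close> is compared with that of \<open>s + w' w\<close> through
  \<open>(s + w w')\<^sup>n w = w (s + w' w)\<^sup>n\<close>, which replaces the equality of the nonzero spectra.\<close>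

lemma nneg_swap:
  assumes adj: "adjr w w'" and "nneg (1 - w' * w)"
  shows "nneg (1 - w * w')"
  unfolding nneg_def
proof (intro allI impI)
  fix e :: real assume "e > 0"
  then have "\<forall>\<^sub>F t in at_top. norm (t *\<^sub>R 1 - (1 - w' * w)) \<le> t + e"
    using assms by (auto simp: nneg_def)
  then show "\<forall>\<^sub>F t in at_top. norm (t *\<^sub>R 1 - (1 - w * w')) \<le> t + e"
    using eventually_ge_at_top[of 1]
  proof eventually_elim
    case (elim t)
    define a where "a = (t - 1) *\<^sub>R 1 + w' * w"
    define b where "b = (t - 1) *\<^sub>R 1 + w * w'"
    define D where "D = norm w * norm w'"
    let ?K = "t + e"
    have K: "?K \<ge> 1" "t - 1 \<ge> 0" "t - 1 \<le> ?K" using elim \<open>e > 0\<close> by auto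
    have D: "D \<ge> 0" by (simp add: D_def)
    have "a = t *\<^sub>R 1 - (1 - w' * w)" by (simp add: a_def scaleR_diff_left)
    then have a: "norm a \<le> ?K" using elim by simp
    have intertwine: "b ^ n * w = w * a ^ n" for n
    proof (induction n)
      case (Suc n)
      have "b ^ Suc n * w = b * (b ^ n * w)" by (simp add: mult.assoc)
      also have "\<dots> = (b * w) * a ^ n" by (simp only: Suc mult.assoc)
      also have "b * w = w * a" by (simp add: a_def b_def distrib_left distrib_right mult.assoc)
      finally show ?case by (simp add: mult.assoc)
    qed simp
    \<comment> \<open>The powers of \<open>b\<close> are bounded by those of \<open>?K\<close> up to
      a linear factor, which the self-adjointness of \<open>b\<close> removes afterwards.
      \<open>?K \<ge> 1\<close> serves to raise the exponent from \<open>n\<close> to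
      \<open>Suc n\<close>.\<close>
    have growth: "norm (b ^ n) \<le> (1 + D * n) * ?K ^ n" for n
    proof (induction n)
      case (Suc n)
      have "b ^ Suc n = b ^ n * b" by (simp add: power_commutes)
      also have "\<dots> = (t - 1) *\<^sub>R b ^ n + b ^ n * w * w'" by (simp add: b_def distrib_left mult.assoc)
      finally have "b ^ Suc n = (t - 1) *\<^sub>R b ^ n + w * a ^ n * w'" by (simp only: intertwine)
      then have "norm (b ^ Suc n) \<le> norm ((t - 1) *\<^sub>R b ^ n) + norm (w * a ^ n * w')"
        by (simp only: norm_triangle_ineq)
      also have "norm ((t - 1) *\<^sub>R b ^ n) \<le> ?K * ((1 + D * n) * ?K ^ n)"
        unfolding norm_scaleR using Suc K by (intro mult_mono) auto
      also have "norm (w * a ^ n * w') \<le> norm w * norm (a ^ n) * norm w'"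
        by (rule order_trans[OF norm_mult_ineq]) (intro mult_right_mono norm_mult_ineq norm_ge_zero)
      also have "\<dots> \<le> norm w * ?K ^ n * norm w'"
        using order_trans[OF norm_power_le power_mono[OF a norm_ge_zero]]
        by (intro mult_left_mono mult_right_mono) auto
      also have "\<dots> = D * ?K ^ n" by (simp add: D_def)
      also have "\<dots> \<le> D * ?K ^ Suc n"
        using K(1) D by (intro mult_left_mono power_increasing) auto
      finally show ?case by (simp add: algebra_simps)
    qed (simp add: norm_one_le)
    have "sa b"
      unfolding b_def using adj by (intro adj_add sa_scaleR_one adj_mult adj_sym[OF adj])
    then have "norm b ^ (2 ^ k) \<le> (1 + D * 2 ^ k) * ?K ^ (2 ^ k)" for k
      using growth[of "2 ^ k"] by (simp add: sa_norm_power_two)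
    then have "norm b \<le> ?K"
      by (rule le_if_power_two_growth[rotated 3]) (use K D in auto)
    moreover have "t *\<^sub>R 1 - (1 - w * w') = b" by (simp add: b_def scaleR_diff_left)
    ultimately show ?case by simp
  qed
qed

text \<open>With \<open>w = x + i y\<close>, this is \<open>2 (x\<^sup>2 + y\<^sup>2)\<close>.\<close>

lemma nneg_adj_anticommutator:
  assumes adj: "adjr w w'"
  shows "nneg (w * w' + w' * w)"
proof -
  define x where "x = w + w'"
  define y where "y = J * (w - w')"
  note adj' = adj_sym[OF adj]
  have "sa x" using adj_add[OF adj adj'] by (simp add: x_def add.commute)
  have diff: "adjr (w - w') (w' - w)" by (intro adj_diff adj adj')
  have Jd: "J * (w - w') = (w - w') * J" by (rule J_central[OF diff])
  have "adjr y ((w' - w) * - J)" unfolding y_def by (intro adj_mult J_adj diff)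
  also have "(w' - w) * - J = y"
    using Jd by (simp add: y_def left_diff_distrib)
  finally have "sa y" .
  have "y * y = J * ((w - w') * J) * (w - w')" by (simp only: y_def mult.assoc)
  also have "\<dots> = (J * J) * ((w - w') * (w - w'))" by (simp only: Jd[symmetric] mult.assoc)
  finally have "y * y = - ((w - w') * (w - w'))" by (simp add: J_square)
  then have "x * x + y * y = 2 *\<^sub>R (w * w' + w' * w)"
    by (simp add: x_def scaleR_2 distrib_left distrib_right left_diff_distrib right_diff_distrib)
  moreover have "nneg ((1/2) *\<^sub>R (x * x + y * y))"
    using \<open>sa x\<close> \<open>sa y\<close> by (intro nneg_scaleR nneg_add nneg_square) auto
  ultimately show ?thesis by simp
qed

text \<open>If \<open>h = c' c\<close> is not nonnegative, then \<open>h (1 - h)\<^sup>2\<^sup>n\<close> is very negative for large \<open>n\<close>, but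
  it is bounded above and of the form \<open>w' w\<close>, hence bounded below as well.\<close>

lemma nneg_adj_mult_of_norm_le_one:
  assumes adj: "adjr c c'" and h1: "norm (c' * c) \<le> 1"
  shows "nneg (c' * c)"
proof -
  define h where "h = c' * c"
  define u where "u = 1 - h"
  have sa_h: "sa h" unfolding h_def by (intro adj_mult adj adj_sym[OF adj])
  have sa_u: "sa u" unfolding u_def by (intro adj_diff adj_one sa_h)
  have h: "norm h \<le> 1" using h1 by (simp add: h_def)
  have hu: "h * u = u * h" by (simp add: u_def left_diff_distrib right_diff_distrib)
  have huj: "h * u ^ j = u ^ j * h" for j
    using power_commuting_commutes[OF hu[symmetric]] by simp
  have odd: "nneg (x * u * x)" if "sa x" "x * h = h * x" for x
    unfolding u_def by (rule nneg_compress[OF sa_h h that])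
  \<comment> \<open>For \<open>j = 2 * i\<close> this is the square of \<open>h * u ^ i\<close>; for
    odd \<open>j\<close> one factor \<open>u = 1 - h\<close> remains in the middle and
    \<open>nneg_compress\<close> applies.\<close>
  have hjh: "nneg (h * u ^ j * h)" for j
  proof (cases "even j")
    case True
    then obtain i where "j = i + i" by (metis evenE mult_2)
    then have "h * u ^ j * h = (h * u ^ i) * (u ^ i * h)"
      by (simp only: power_add mult.assoc)
    then have "h * u ^ j * h = (h * u ^ i) * (h * u ^ i)"
      by (simp only: huj[symmetric])
    then show ?thesis using sa_mult[OF sa_h sa_power[OF sa_u] huj] nneg_square by metis
  next
    case False
    then obtain i where i: "j = i + 1 + i" by (metis oddE mult_2 add.assoc add.commute)
    have "h * u ^ j * h = (h * u ^ i) * u * (u ^ i * h)"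
      by (simp only: i power_add power_one_right mult.assoc)
    then have "h * u ^ j * h = (h * u ^ i) * u * (h * u ^ i)"
      by (simp only: huj[symmetric])
    moreover have "(h * u ^ i) * h = h * (h * u ^ i)"
      by (simp only: huj[symmetric] mult.assoc)
    ultimately show ?thesis
      using odd sa_mult[OF sa_h sa_power[OF sa_u] huj] by metis
  qed
  have bounded: "norm (h * u ^ (2 * n)) \<le> exp 4" for n
  proof -
    define w where "w = c * u ^ n"
    define w' where "w' = u ^ n * c'"
    have w: "adjr w w'" unfolding w_def w'_def by (intro adj_mult adj sa_power sa_u)
    have "w' * w = u ^ n * h * u ^ n" by (simp only: w_def w'_def h_def mult.assoc)
    also have "\<dots> = h * u ^ (2 * n)" by (simp only: huj[symmetric] mult.assoc power_add[symmetric] mult_2)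
    finally have w'w: "w' * w = h * u ^ (2 * n)" .
    have telescope: "h * (\<Sum>j<m. u ^ j) = 1 - u ^ m" for m
      by (induction m) (simp_all add: distrib_left u_def left_diff_distrib)
    \<comment> \<open>As \<open>h + u = 1\<close>, the left-hand side is
      \<open>h * (1 - u ^ (2 * n)) + u\<close>, and the geometric sum splits the first summand into
      terms \<open>h * u ^ j * h\<close>, all nonnegative.\<close>
    have "1 - h * u ^ (2 * n) = h * (1 - u ^ (2 * n)) + 1 * u * 1"
      by (simp add: u_def right_diff_distrib)
    also have "\<dots> = (\<Sum>j<2 * n. h * u ^ j * h) + 1 * u * 1"
      unfolding telescope[symmetric] by (simp only: sum_distrib_left huj[symmetric] mult.assoc)
    finally have "1 - w' * w = (\<Sum>j<2 * n. h * u ^ j * h) + 1 * u * 1" by (simp only: w'w)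
    moreover have "nneg ((\<Sum>j<2 * n. h * u ^ j * h) + 1 * u * 1)"
      by (intro nneg_add nneg_sum hjh odd adj_one) simp
    ultimately have upper: "nneg (1 - w' * w)" by simp
    \<comment> \<open>The upper bound is moved from \<open>w' * w\<close> to \<open>w * w'\<close>;
      adding the anticommutator then turns \<open>1 - w * w'\<close> into
      \<open>1 + w' * w\<close>.\<close>
    have "nneg ((1 - w * w') + (w * w' + w' * w))"
      by (rule nneg_add[OF nneg_swap[OF w upper] nneg_adj_anticommutator[OF w]])
    then have lower: "nneg (1 + w' * w)" by simp
    have "sa (w' * w)" by (intro adj_mult w adj_sym[OF w])
    from norm_le_exp_if_nneg[OF this upper lower] show ?thesis by (simp only: w'w)
  qed
  \<comment> \<open>Because \<open>u * u = 1 - h * (1 + u)\<close>, consecutive even powers of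
    \<open>u\<close> differ by \<open>h * u ^ (2 * n) * (1 + u)\<close>, which is bounded uniformly
    in \<open>n\<close>. Hence the growth is at most linear, and for a self-adjoint element this
    forces norm at most 1.\<close>
  have growth: "norm (u ^ (2 * n)) \<le> 1 + (3 * exp 4) * n" for n
  proof (induction n)
    case (Suc n)
    have "u ^ (2 * Suc n) = u ^ (2 * n) * (u * u)"
      by (simp add: power_add[symmetric] power2_eq_square[symmetric])
    also have "u * u = 1 - h * (1 + u)"
      by (simp add: u_def left_diff_distrib right_diff_distrib distrib_left)
    finally have "u ^ (2 * Suc n) = u ^ (2 * n) - h * u ^ (2 * n) * (1 + u)"
      by (simp only: right_diff_distrib mult_1_right huj mult.assoc)
    then have "norm (u ^ (2 * Suc n)) \<le> norm (u ^ (2 * n)) + norm (h * u ^ (2 * n) * (1 + u))"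
      by (simp only: norm_triangle_ineq4)
    also have "norm (1 + u) \<le> 3"
      using norm_triangle_ineq[of 1 u] norm_triangle_ineq4[of 1 h] norm_one_le h by (simp add: u_def)
    then have "norm (h * u ^ (2 * n) * (1 + u)) \<le> exp 4 * 3"
      by (intro order_trans[OF norm_mult_ineq] mult_mono bounded) auto
    finally show ?case using Suc by (simp add: algebra_simps)
  qed (simp add: norm_one_le)
  have "norm (u ^ 2) ^ (2 ^ k) \<le> (1 + (3 * exp 4) * 2 ^ k) * 1 ^ (2 ^ k)" for k
    unfolding sa_norm_power_two[OF sa_power[OF sa_u], symmetric] power_mult[symmetric]
    using growth[of "2 ^ k"] by simp
  then have "norm (u ^ 2) \<le> 1"
    by (rule le_if_power_two_growth[rotated 3]) auto
  then have "norm u \<le> 1"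
    using sa_norm_power_two[OF sa_u, of 1] by (simp add: power_le_one_iff)
  from nneg_norm_le[OF this] show ?thesis by (simp add: u_def h_def)
qed

lemma nneg_adj_mult:
  assumes adj: "adjr c c'"
  shows "nneg (c' * c)"
proof -
  define N where "N = 1 + norm (c' * c)"
  define r where "r = 1 / sqrt N"
  have N: "N > 0" "norm (c' * c) \<le> N" using norm_ge_zero[of "c' * c"] unfolding N_def by linarith+
  have rr: "r * r = 1 / N" using N(1) by (simp add: r_def)
  have eq: "(r *\<^sub>R c') * (r *\<^sub>R c) = (1 / N) *\<^sub>R (c' * c)" by (simp add: rr)
  have "norm ((r *\<^sub>R c') * (r *\<^sub>R c)) \<le> 1"
    unfolding eq using N by (simp add: field_simps)
  from nneg_adj_mult_of_norm_le_one[OF adj_scaleR[OF adj] this]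
  have "nneg ((1 / N) *\<^sub>R (c' * c))" by (simp only: eq)
  from nneg_scaleR[OF this, of N] show ?thesis using N(1) by simp
qed

text \<open>For \<delta> slightly above the norm of the sum,
  \<open>0 \<le> d' * d \<le> c' * c + d' * d \<le> \<delta>\<close> in the order of the cone, so
  \<open>d' * d\<close> divided by \<delta> lies between -1 and 1 and
  \<open>norm_le_exp_if_nneg\<close> applies. The slack keeps \<delta> positive.\<close>

lemma norm_le_norm_add_adj_mult:
  assumes "adjr c c'" "adjr d d'"
  shows "norm (d' * d) \<le> exp 4 * norm (c' * c + d' * d)"
proof (rule field_le_epsilon)
  fix e :: real assume "e > 0"
  define h where "h = d' * d"
  define \<delta> where "\<delta> = norm (c' * c + h) + e / exp 4"
  have \<delta>: "\<delta> > 0" using \<open>e > 0\<close> by (simp add: \<delta>_def add_nonneg_pos)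
  have "nneg (\<delta> *\<^sub>R 1 - (c' * c + h))"
    using \<open>e > 0\<close> by (intro nneg_norm_le) (simp add: \<delta>_def)
  from nneg_add[OF this nneg_adj_mult[OF assms(1)]] have "nneg (\<delta> *\<^sub>R 1 - h)" by simp
  then have "nneg ((1 / \<delta>) *\<^sub>R (\<delta> *\<^sub>R 1 - h))" using \<delta> by (intro nneg_scaleR) auto
  then have upper: "nneg (1 - (1 / \<delta>) *\<^sub>R h)" using \<delta> by (simp add: scaleR_diff_right)
  have "nneg (1 *\<^sub>R 1 - 0)" by (intro nneg_norm_le) simp
  moreover have "nneg ((1 / \<delta>) *\<^sub>R h)"
    using \<delta> nneg_adj_mult[OF assms(2)] by (intro nneg_scaleR) (auto simp: h_def)
  ultimately have lower: "nneg (1 + (1 / \<delta>) *\<^sub>R h)" using nneg_add by fastforce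
  have "sa ((1 / \<delta>) *\<^sub>R h)"
    unfolding h_def by (intro adj_scaleR adj_mult assms adj_sym[OF assms(2)])
  from norm_le_exp_if_nneg[OF this upper lower] have "norm h \<le> exp 4 * \<delta>"
    using \<delta> by (simp add: field_simps)
  then show "norm (d' * d) \<le> exp 4 * norm (c' * c + d' * d) + e"
    by (simp add: \<delta>_def h_def algebra_simps)
qed

end

section \<open>Bounded operators on a \<open>C\<^sup>*\<close>-algebra\<close>

text \<open>A copy of the bounded endomorphisms as a type of its own, so that composition can be the
  multiplication of a type class.\<close>

typedef (overloaded) 'a endo = "UNIV :: ('a::real_normed_vector \<Rightarrow>\<^sub>L 'a) set"
  morphisms blinfun_of_endo endo_of_blinfun ..

setup_lifting type_definition_endo

instantiation endo :: (real_normed_vector) real_normed_algebra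
begin

lift_definition zero_endo :: "'a endo" is 0 .
lift_definition plus_endo :: "'a endo \<Rightarrow> 'a endo \<Rightarrow> 'a endo" is "(+)" .
lift_definition minus_endo :: "'a endo \<Rightarrow> 'a endo \<Rightarrow> 'a endo" is "(-)" .
lift_definition uminus_endo :: "'a endo \<Rightarrow> 'a endo" is uminus .
lift_definition scaleR_endo :: "real \<Rightarrow> 'a endo \<Rightarrow> 'a endo" is scaleR .
lift_definition times_endo :: "'a endo \<Rightarrow> 'a endo \<Rightarrow> 'a endo" is "(o\<^sub>L)" .
lift_definition norm_endo :: "'a endo \<Rightarrow> real" is norm .

definition sgn_endo :: "'a endo \<Rightarrow> 'a endo" where
  "sgn_endo T = inverse (norm T) *\<^sub>R T"
definition dist_endo :: "'a endo \<Rightarrow> 'a endo \<Rightarrow> real" where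
  "dist_endo S T = norm (S - T)"
definition uniformity_endo :: "('a endo \<times> 'a endo) filter" where
  "uniformity_endo = (INF e\<in>{0<..}. principal {(S, T). dist S T < e})"
definition open_endo :: "'a endo set \<Rightarrow> bool" where
  "open_endo X \<longleftrightarrow> (\<forall>S\<in>X. \<forall>\<^sub>F (S', T) in uniformity. S' = S \<longrightarrow> T \<in> X)"

instance
proof
  fix S T R :: "'a endo" and r s :: real
  show "S * T * R = S * (T * R)" by transfer (auto intro!: blinfun_eqI)
  show "(S + T) * R = S * R + T * R" by transfer (auto intro!: blinfun_eqI simp: blinfun.bilinear_simps)
  show "S * (T + R) = S * T + S * R" by transfer (auto intro!: blinfun_eqI simp: blinfun.bilinear_simps)
  show "r *\<^sub>R S * T = r *\<^sub>R (S * T)" by transfer (auto intro!: blinfun_eqI simp: blinfun.bilinear_simps)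
  show "S * r *\<^sub>R T = r *\<^sub>R (S * T)" by transfer (auto intro!: blinfun_eqI simp: blinfun.bilinear_simps)
  show "norm (S * T) \<le> norm S * norm T" by transfer (rule norm_blinfun_compose)
  show "norm (S + T) \<le> norm S + norm T" by transfer (rule norm_triangle_ineq)
  show "norm S = 0 \<longleftrightarrow> S = 0" by transfer simp
  show "norm (r *\<^sub>R S) = \<bar>r\<bar> * norm S" by transfer simp
qed (rule sgn_endo_def dist_endo_def uniformity_endo_def open_endo_def |
    (transfer, simp add: algebra_simps))+

end

text \<open>The unit is introduced through \<open>monoid_mult\<close> because \<open>1 = 0\<close>
  on the zero space, which \<open>ring_1\<close> rules out.\<close>

instantiation endo :: (real_normed_vector) monoid_mult
begin

lift_definition one_endo :: "'a endo" is id_blinfun .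

instance
  by standard (transfer, auto intro!: blinfun_eqI)+

end

lift_definition endo_apply :: "'a::real_normed_vector endo \<Rightarrow> 'a \<Rightarrow> 'a" is blinfun_apply .

lemma endo_eqI: "(\<And>x. endo_apply S x = endo_apply T x) \<Longrightarrow> S = T"
  by transfer (rule blinfun_eqI)

lemma endo_apply_simps [simp]:
  "endo_apply 1 x = x"
  "endo_apply (S * T) x = endo_apply S (endo_apply T x)"
  "endo_apply (S + T) x = endo_apply S x + endo_apply T x"
  "endo_apply (- S) x = - endo_apply S x"
  "endo_apply (r *\<^sub>R S) x = r *\<^sub>R endo_apply S x"
  "endo_apply T (x + y) = endo_apply T x + endo_apply T y"
  by (transfer, simp add: blinfun.bilinear_simps)+

lemma norm_endo_apply: "norm (endo_apply T x) \<le> norm T * norm x"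
  by transfer (rule norm_blinfun)

lemma norm_endo_bound:
  "0 \<le> b \<Longrightarrow> (\<And>x. norm (endo_apply T x) \<le> b * norm x) \<Longrightarrow> norm T \<le> b"
  by transfer (rule norm_blinfun_bound)

lift_definition endo_of :: "('a \<Rightarrow> 'a) \<Rightarrow> 'a::real_normed_vector endo" is Blinfun .

lemma endo_apply_endo_of: "bounded_linear f \<Longrightarrow> endo_apply (endo_of f) = f"
  by transfer (rule bounded_linear_Blinfun_apply)

context
  fixes scA :: "complex \<Rightarrow> 'a::{real_normed_algebra,banach} \<Rightarrow> 'a" and st :: "'a \<Rightarrow> 'a"
  assumes C: "cstar_algebra scA st"
begin

lemma scA_of_real: "scA (complex_of_real r) a = r *\<^sub>R a"
  and scA_add: "scA c (a + b) = scA c a + scA c b"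
  and scA_scA: "scA c (scA d a) = scA (c * d) a"
  and scA_mult: "scA c a * b = scA c (a * b)" "a * scA c b = scA c (a * b)"
  and norm_scA: "norm (scA c a) = cmod c * norm a"
  and st_add: "st (a + b) = st a + st b"
  and st_scA: "st (scA c a) = scA (cnj c) (st a)"
  and st_mult: "st (a * b) = st b * st a"
  and st_st: "st (st a) = a"
  and norm_st_mult: "norm (st a * a) = (norm a)\<^sup>2"
  using C unfolding cstar_algebra_def by metis+

lemma st_scaleR: "st (r *\<^sub>R a) = r *\<^sub>R st a"
  using st_scA[of "of_real r" a] by (simp only: scA_of_real complex_cnj_complex_of_real)

lemma st_mult_self_eq_0: "st a * a = 0 \<Longrightarrow> a = 0"
  using norm_st_mult[of a] by simp

lemma norm_st: "norm (st a) = norm a"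
proof -
  have le: "norm b \<le> norm (st b)" for b
  proof (cases "b = 0")
    case False
    have "norm b * norm b \<le> norm (st b) * norm b"
      using norm_st_mult[of b] norm_mult_ineq[of "st b" b] by (simp add: power2_eq_square)
    then show ?thesis using False by simp
  qed simp
  show ?thesis using le[of a] le[of "st a"] by (simp add: st_st)
qed

lemma bounded_linear_scA: "bounded_linear (scA c)"
proof
  show "scA c (r *\<^sub>R a) = r *\<^sub>R scA c a" for r a
    by (simp only: scA_of_real[symmetric] scA_scA mult.commute)
  show "\<exists>K. \<forall>a. norm (scA c a) \<le> norm a * K"
    by (intro exI[of _ "cmod c"]) (simp add: norm_scA)
qed (rule scA_add)

text \<open>The algebra is regarded as a Hilbert module over itself, with inner product
  \<open>st x * y\<close>.\<close>

definition endo_adj :: "'a endo \<Rightarrow> 'a endo \<Rightarrow> bool" where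
  "endo_adj T S \<longleftrightarrow> (\<forall>x y. st (endo_apply T x) * y = st x * endo_apply S y)"

lemma st_mult_cancel:
  assumes "\<And>y. st a * y = st b * y"
  shows "a = b"
proof -
  have "st (a - b) * (a - b) = 0"
  proof -
    have "st (a - b) = st a - st b"
      using st_add[of "a - b" b] by (simp add: algebra_simps)
    then show ?thesis by (simp add: left_diff_distrib assms)
  qed
  from st_mult_self_eq_0[OF this] show ?thesis by simp
qed

lemma star_algebra_endo: "star_algebra endo_adj (endo_of (scA \<i>))"
proof
  note J = endo_apply_endo_of[OF bounded_linear_scA]
  show "norm (1 :: 'a endo) \<le> 1" by (rule norm_endo_bound) auto
  show "endo_adj 1 1" by (simp add: endo_adj_def)
  show "endo_of (scA \<i>) * endo_of (scA \<i>) = - 1"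
  proof (rule endo_eqI)
    show "endo_apply (endo_of (scA \<i>) * endo_of (scA \<i>)) x = endo_apply (- 1) x" for x
      using scA_of_real[of "-1" x] by (simp add: J scA_scA)
  qed
  show "endo_adj (endo_of (scA \<i>)) (- endo_of (scA \<i>))"
  proof -
    have "scA (- \<i>) a = - scA \<i> a" for a
      using scA_scA[of "of_real (- 1)" \<i> a] by (simp only: scA_of_real) simp
    then show ?thesis by (simp add: endo_adj_def J st_scA scA_mult)
  qed
  fix a a' b b' :: "'a endo" and r :: real
  assume a: "endo_adj a a'"
  show "endo_adj (r *\<^sub>R a) (r *\<^sub>R a')" using a by (simp add: endo_adj_def st_scaleR)
  show "endo_adj a' a"
    unfolding endo_adj_def
  proof (intro allI)
    fix x y
    have "st (st (endo_apply a y) * x) = st (st y * endo_apply a' x)" using a by (simp add: endo_adj_def)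
    then show "st (endo_apply a' x) * y = st x * endo_apply a y" by (simp add: st_mult st_st)
  qed
  \<comment> \<open>The square of \<open>norm (endo_apply a x)\<close> is the norm of
    \<open>st x * endo_apply (a' * a) x\<close>, and submultiplicativity finishes.\<close>
  show "(norm a)\<^sup>2 \<le> norm (a' * a)"
  proof -
    have "norm (endo_apply a x) \<le> sqrt (norm (a' * a)) * norm x" for x
    proof -
      have "(norm (endo_apply a x))\<^sup>2 = norm (st x * endo_apply (a' * a) x)"
        using a by (simp add: norm_st_mult[symmetric] endo_adj_def)
      also have "\<dots> \<le> norm x * (norm (a' * a) * norm x)"
        using norm_mult_ineq[of "st x" "endo_apply (a' * a) x"]
          mult_left_mono[OF norm_endo_apply[of "a' * a" x] norm_ge_zero[of x]]
        unfolding norm_st by linarith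
      finally have "(norm (endo_apply a x))\<^sup>2 \<le> (sqrt (norm (a' * a)) * norm x)\<^sup>2"
        by (simp add: power_mult_distrib) (simp add: power2_eq_square algebra_simps)
      then show ?thesis by (rule power2_le_imp_le) simp
    qed
    then have "norm a \<le> sqrt (norm (a' * a))" by (intro norm_endo_bound) auto
    then have "(norm a)\<^sup>2 \<le> (sqrt (norm (a' * a)))\<^sup>2" by (intro power_mono) auto
    then show ?thesis by simp
  qed
  \<comment> \<open>Elements of the type are only real-linear; the existence of an adjoint makes
    \<open>a\<close> complex-linear.\<close>
  show "endo_of (scA \<i>) * a = a * endo_of (scA \<i>)"
  proof (rule endo_eqI)
    fix x
    have "st (scA \<i> (endo_apply a x)) * y = st (endo_apply a (scA \<i> x)) * y" for y
      using a by (simp add: endo_adj_def st_scA scA_mult)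
    then have "scA \<i> (endo_apply a x) = endo_apply a (scA \<i> x)" by (rule st_mult_cancel)
    then show "endo_apply (endo_of (scA \<i>) * a) x = endo_apply (a * endo_of (scA \<i>)) x"
      by (simp add: J)
  qed
  assume b: "endo_adj b b'"
  show "endo_adj (a + b) (a' + b')"
    using a b by (simp add: endo_adj_def st_add distrib_left distrib_right)
  show "endo_adj (a * b) (b' * a')"
    using a b by (simp add: endo_adj_def)
qed

text \<open>The inequality is transported along left multiplication \<open>L\<close>, which respects
  sums, products and adjoints. It is isometric: \<open>norm a \<le> norm (L a)\<close> follows by
  testing \<open>L a\<close> on \<open>st a\<close>.\<close>

lemma norm_st_mult_le_norm_add:
  "norm (st d * d) \<le> exp 4 * norm (st c * c + st d * d)"
proof -
  interpret star_algebra endo_adj "endo_of (scA \<i>)" by (rule star_algebra_endo)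
  define L where "L = (\<lambda>a :: 'a. endo_of ((*) a))"
  have L: "endo_apply (L a) x = a * x" for a x
    by (simp add: L_def endo_apply_endo_of bounded_linear_mult_right)
  have L_adj: "endo_adj (L a) (L (st a))" for a
    by (simp add: endo_adj_def L st_mult mult.assoc)
  have L_le: "norm (L a) \<le> norm a" for a
    by (rule norm_endo_bound) (simp_all add: L norm_mult_ineq)
  have le_L: "norm a \<le> norm (L a)" for a
  proof (cases "a = 0")
    case False
    have "norm a * norm a = norm (endo_apply (L a) (st a))"
      using norm_st_mult[of "st a"] by (simp add: L st_st norm_st power2_eq_square)
    also have "\<dots> \<le> norm (L a) * norm a"
      using norm_endo_apply[of "L a" "st a"] by (simp add: norm_st)
    finally show ?thesis using False by simp
  qed simp
  have L_mult: "L (st a) * L a = L (st a * a)" for a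
    by (rule endo_eqI) (simp add: L mult.assoc)
  have L_add: "L a + L b = L (a + b)" for a b
    by (rule endo_eqI) (simp add: L distrib_right)
  have "norm (st d * d) \<le> norm (L (st d * d))" by (rule le_L)
  also have "\<dots> \<le> exp 4 * norm (L (st c * c + st d * d))"
    using norm_le_norm_add_adj_mult[OF L_adj[of c] L_adj[of d]] by (simp only: L_mult L_add)
  also have "\<dots> \<le> exp 4 * norm (st c * c + st d * d)"
    by (intro mult_left_mono L_le) simp
  finally show ?thesis .
qed

end

section \<open>Hilbert modules\<close>

context
  fixes scA :: "complex \<Rightarrow> 'a::{real_normed_algebra,banach} \<Rightarrow> 'a"
    and st :: "'a \<Rightarrow> 'a"
    and scH :: "complex \<Rightarrow> 'h::ab_group_add \<Rightarrow> 'h"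
    and act :: "'h \<Rightarrow> 'a \<Rightarrow> 'h"
    and ip :: "'h \<Rightarrow> 'h \<Rightarrow> 'a"
  assumes H: "hilbert_cstar_module scA st scH act ip"
begin

lemma module_cstar_algebra: "cstar_algebra scA st"
  and ip_add_right: "ip x (y + z) = ip x y + ip x z"
  and st_ip: "st (ip x y) = ip y x"
  and ip_self_pos: "cstar_pos st (ip x x)"
  and ip_self_eq_0: "ip x x = 0 \<Longrightarrow> x = 0"
  using H unfolding hilbert_cstar_module_def by metis+

lemma ip_add_left: "ip (x + y) z = ip x z + ip y z"
  by (metis ip_add_right st_ip st_add[OF module_cstar_algebra])

lemma ip_diff_right: "ip x (y - z) = ip x y - ip x z"
  using ip_add_right[of x "y - z" z] by simp

lemma ip_diff_left: "ip (x - y) z = ip x z - ip y z"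
  using ip_add_left[of "x - y" y z] by simp

lemma ip_zero_right: "ip x 0 = 0"
  using ip_diff_right[of x 0 0] by simp

lemma ip_zero_left: "ip 0 x = 0"
  using ip_diff_left[of 0 0 x] by simp

lemma ip_eq_0_sym: "ip x y = 0 \<Longrightarrow> ip y x = 0"
  by (metis ip_zero_left ip_zero_right st_ip)

lemma subset_hclosure: "S \<subseteq> hclosure ip S"
proof
  fix x assume "x \<in> S"
  then show "x \<in> hclosure ip S"
    unfolding hclosure_def hconv_def
    by (intro CollectI exI[of _ "\<lambda>_. x"]) (simp add: hnorm_def ip_zero_left)
qed

lemma hclosure_inter_orth:
  assumes x: "x \<in> hclosure ip S" and orth: "\<And>s. s \<in> S \<Longrightarrow> ip s x = 0"
  shows "x = 0"
proof -
  obtain X where X: "\<And>n. X n \<in> S" and conv: "hconv ip X x"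
    using x by (auto simp: hclosure_def)
  have "norm (ip x x) \<le> 0 + e" if "e > 0" for e
  proof -
    \<comment> \<open>The square of \<open>d\<close> times \<open>exp 4\<close> is \<open>e\<close>,
      which absorbs the constant in the norm inequality.\<close>
    define d where "d = sqrt (e / exp 4)"
    have "d > 0" using that by (simp add: d_def)
    then obtain n where "hnorm ip (X n - x) < d"
      using conv by (auto simp: hconv_def)
    then have "sqrt (norm (ip (X n - x) (X n - x))) < sqrt (e / exp 4)"
      by (simp add: hnorm_def d_def)
    then have small: "norm (ip (X n - x) (X n - x)) < e / exp 4"
      by simp
    have pythagoras: "ip (X n - x) (X n - x) = ip (X n) (X n) + ip x x"
      using orth[OF X[of n]] ip_eq_0_sym[OF orth[OF X[of n]]]
      by (simp add: ip_diff_left ip_diff_right)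
    obtain b c where "ip x x = st b * b" "ip (X n) (X n) = st c * c"
      using ip_self_pos by (metis cstar_pos_def)
    then have "norm (ip x x) \<le> exp 4 * norm (ip (X n - x) (X n - x))"
      using norm_st_mult_le_norm_add[OF module_cstar_algebra, of b c] pythagoras by simp
    also have "\<dots> \<le> e" using small by (simp add: field_simps)
    finally show ?thesis by simp
  qed
  then have "norm (ip x x) \<le> 0" by (rule field_le_epsilon)
  then show ?thesis by (simp add: ip_self_eq_0)
qed

lemma eq_if_ip_eq:
  assumes "x \<in> M" "y \<in> M" "\<And>a b. a \<in> M \<Longrightarrow> b \<in> M \<Longrightarrow> a - b \<in> M"
    and "\<And>z. z \<in> M \<Longrightarrow> ip z x = ip z y"
  shows "x = y"
proof -
  have "ip (x - y) (x - y) = 0" using assms by (simp add: ip_diff_right[of "x - y"])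
  from ip_self_eq_0[OF this] show ?thesis by simp
qed

text \<open>\<open>adj\<close> is a definite description, so uniqueness of the adjoint has to be
  shown before \<open>adj ip P = P\<close> says anything about \<open>P\<close>.\<close>

lemma projection_self_adjoint:
  assumes "is_projection ip P"
  shows "ip (P x) y = ip x (P y)"
proof -
  obtain S where S: "\<forall>x y. ip (P x) y = ip x (S y)"
    using assms by (auto simp: is_projection_def adjointable_def)
  have "\<exists>!S. \<forall>x y. ip (P x) y = ip x (S y)"
  proof (rule ex1I, rule S)
    fix R assume R: "\<forall>x y. ip (P x) y = ip x (R y)"
    show "R = S"
    proof
      fix y show "R y = S y"
        by (rule eq_if_ip_eq[of _ UNIV]) (use R S in simp_all)
    qed
  qed
  then have "\<forall>x y. ip (P x) y = ip x (adj ip P y)" unfolding adj_def by (rule theI')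
  moreover have "adj ip P = P" using assms by (simp add: is_projection_def)
  ultimately show ?thesis by simp
qed

lemma projection_diff:
  assumes "is_projection ip P"
  shows "P (x - y) = P x - P y"
  by (rule eq_if_ip_eq[of _ UNIV])
    (simp_all add: projection_self_adjoint[OF assms, symmetric] ip_diff_right)

text \<open>The description in \<open>adj_sub\<close> is unique: inner products with
  \<open>M\<close> determine the values on \<open>N\<close>, and elsewhere the value is fixed to be
  0.\<close>

lemma adj_sub_spec:
  assumes T: "adj_between ip M N T" and M: "\<And>a b. a \<in> M \<Longrightarrow> b \<in> M \<Longrightarrow> a - b \<in> M"
  shows "y \<in> N \<Longrightarrow> adj_sub ip M N T y \<in> M"
    and "x \<in> M \<Longrightarrow> y \<in> N \<Longrightarrow> ip (T x) y = ip x (adj_sub ip M N T y)"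
proof -
  obtain S where S: "\<forall>y\<in>N. S y \<in> M" "\<forall>x\<in>M. \<forall>y\<in>N. ip (T x) y = ip x (S y)"
    using T by (auto simp: adj_between_def)
  let ?P = "\<lambda>S. (\<forall>y. y \<notin> N \<longrightarrow> S y = 0) \<and> (\<forall>y\<in>N. S y \<in> M) \<and> (\<forall>x\<in>M. \<forall>y\<in>N. ip (T x) y = ip x (S y))"
  have "\<exists>!S. ?P S"
  proof (rule ex1I)
    show "?P (\<lambda>y. if y \<in> N then S y else 0)" using S by auto
    fix R assume R: "?P R"
    show "R = (\<lambda>y. if y \<in> N then S y else 0)"
    proof
      fix y show "R y = (if y \<in> N then S y else 0)"
        using R S by (auto intro!: eq_if_ip_eq[of _ M] M)
    qed
  qed
  then have "?P (adj_sub ip M N T)" unfolding adj_sub_def by (rule theI')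
  then show "y \<in> N \<Longrightarrow> adj_sub ip M N T y \<in> M"
    and "x \<in> M \<Longrightarrow> y \<in> N \<Longrightarrow> ip (T x) y = ip x (adj_sub ip M N T y)" by auto
qed

text \<open>\<open>adj_between\<close> does not mention linearity; additivity is recovered from the
  adjoint by moving \<open>T\<close> to the other side of the inner product.\<close>

lemma diff_if_adjoint:
  assumes "\<And>x. x \<in> M \<Longrightarrow> T x \<in> N" and "\<And>x y. x \<in> M \<Longrightarrow> y \<in> N \<Longrightarrow> ip (T x) y = ip x (S y)"
    and "\<And>a b. a \<in> M \<Longrightarrow> b \<in> M \<Longrightarrow> a - b \<in> M" "\<And>a b. a \<in> N \<Longrightarrow> b \<in> N \<Longrightarrow> a - b \<in> N"
    and "x \<in> M" "y \<in> M"
  shows "T (x - y) = T x - T y"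
proof (rule eq_if_ip_eq[of _ N])
  fix z assume "z \<in> N"
  then have "ip (T (x - y)) z = ip (T x - T y) z"
    using assms by (simp add: ip_diff_left)
  then show "ip z (T (x - y)) = ip z (T x - T y)" by (metis st_ip)
qed (simp_all add: assms)

end

section \<open>The equivalences for the block operators\<close>

theorem theorem3p5:
  fixes scA :: "complex \<Rightarrow> 'a::{real_normed_algebra,banach} \<Rightarrow> 'a"
    and st :: "'a \<Rightarrow> 'a"
    and scH :: "complex \<Rightarrow> 'h::ab_group_add \<Rightarrow> 'h"
    and act :: "'h \<Rightarrow> 'a \<Rightarrow> 'h"
    and ip :: "'h \<Rightarrow> 'h \<Rightarrow> 'a"
    and P Q A U Q0 :: "'h \<Rightarrow> 'h"
  assumes H: "hilbert_cstar_module scA st scH act ip"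
    and PQ: "harmonious ip P Q"
    and nontriv: "P \<noteq> (\<lambda>x. 0)" "P \<noteq> id"
    and A_op: "adj_between ip (range P) (range P) A"
    and A_sa: "\<forall>x\<in>range P. \<forall>y\<in>range P. ip (A x) y = ip x (A y)"
    and A_pos: "op_pos ip (range P) (\<lambda>x. A (A x) - A x)"
    and U_op: "adj_between ip (range P) (kern P) U"
    and U_pi: "\<forall>x\<in>range P. U (adj_sub ip (range P) (kern P) U (U x)) = U x"
    and Q0_op: "adj_between ip (kern P) (kern P) Q0"
    and Q0_proj: "\<forall>y\<in>kern P. Q0 (Q0 y) = Q0 y"
                 "\<forall>x\<in>kern P. \<forall>y\<in>kern P. ip (Q0 x) y = ip x (Q0 y)"
    and range_Ustar: "adj_sub ip (range P) (kern P) U ` kern P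
                        = hclosure ip ((\<lambda>x. A (A x) - A x) ` range P)"
    and Ustar_Q0: "\<forall>y\<in>kern P. adj_sub ip (range P) (kern P) U (Q0 y) = 0"
    and block: "\<forall>u\<in>range P. \<forall>v\<in>kern P.
        P (Q (u + v)) = A u - ell ip (range P) A (adj_sub ip (range P) (kern P) U v) \<and>
        Q (u + v) - P (Q (u + v)) =
          U (ell ip (range P) A u)
          + (U (adj_sub ip (range P) (kern P) U v - A (adj_sub ip (range P) (kern P) U v)) + Q0 v)"
  shows "let Us = adj_sub ip (range P) (kern P) U;
             Q22 = (\<lambda>y. U (Us y - A (Us y)) + Q0 y);
             c1 = (sub_kern (range P) A = {0} \<and> sub_kern (range P) (\<lambda>x. x - A x) = {0}
                   \<and> sub_kern (kern P) Us = {0});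
             c2 = (sub_kern (range P) (\<lambda>x. A (A x) - A x) = {0} \<and> sub_kern (kern P) Us = {0});
             c3 = ((\<forall>x\<in>range P. Us (U x) = x) \<and> (\<forall>y\<in>kern P. U (Us y) = y));
             c4 = (sub_kern (range P) A = {0} \<and> sub_kern (range P) (\<lambda>x. x - A x) = {0}
                   \<and> sub_kern (kern P) Q22 = {0} \<and> sub_kern (kern P) (\<lambda>y. y - Q22 y) = {0})
         in (c1 \<longleftrightarrow> c2) \<and> (c2 \<longleftrightarrow> c3) \<and> (c3 \<longleftrightarrow> c4)"
proof -
  define M where "M = range P"
  define N where "N = kern P"
  note A_op = A_op[folded M_def] and A_sa = A_sa[folded M_def]
    and U_op = U_op[folded M_def N_def] and U_pi = U_pi[folded M_def N_def]
    and Q0_op = Q0_op[folded N_def] and Q0_proj = Q0_proj[folded N_def]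
    and range_Ustar = range_Ustar[folded M_def N_def] and Ustar_Q0 = Ustar_Q0[folded M_def N_def]
  define Us where "Us = adj_sub ip M N U"
  define T where "T = (\<lambda>x. A (A x) - A x)"
  have P: "is_projection ip P"
    using PQ by (simp add: harmonious_def quasi_projection_pair_def)
  note P_diff = projection_diff[OF H P]
  have M_diff: "a - b \<in> M" if "a \<in> M" "b \<in> M" for a b
    using that by (auto simp: M_def P_diff[symmetric])
  have N_diff: "a - b \<in> N" if "a \<in> N" "b \<in> N" for a b
    using that P_diff by (simp add: N_def kern_def)
  have P_0: "P 0 = 0" using P_diff[of 0 0] by simp
  have M_0: "0 \<in> M" using P_0 unfolding M_def by (metis rangeI)
  have N_0: "0 \<in> N" using P_0 by (simp add: N_def kern_def)

  have A_in: "A x \<in> M" if "x \<in> M" for x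
    using A_op that by (simp add: adj_between_def)
  have A_diff: "A (x - y) = A x - A y" if "x \<in> M" "y \<in> M" for x y
    by (rule diff_if_adjoint[OF H, of M A M A]) (use A_in A_sa M_diff that in auto)
  have A_0: "A 0 = 0" using A_diff[OF M_0 M_0] by simp
  have T_in: "T x \<in> M" if "x \<in> M" for x
    using that by (simp add: T_def A_in M_diff)
  have T_sa: "ip (T x) y = ip x (T y)" if "x \<in> M" "y \<in> M" for x y
    using that A_sa by (simp add: T_def A_in ip_diff_left[OF H] ip_diff_right[OF H])
  have T_0: "T 0 = 0" by (simp add: T_def A_0)

  have U_in: "U x \<in> N" if "x \<in> M" for x
    using U_op that by (simp add: adj_between_def)
  have Us_in: "Us y \<in> M" if "y \<in> N" for y
    unfolding Us_def by (rule adj_sub_spec(1)[OF H U_op M_diff that])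
  have U_Us: "ip (U x) y = ip x (Us y)" if "x \<in> M" "y \<in> N" for x y
    unfolding Us_def by (rule adj_sub_spec(2)[OF H U_op M_diff that])
  have Us_U: "ip (Us y) x = ip y (U x)" if "x \<in> M" "y \<in> N" for x y
    using U_Us[OF that] by (metis st_ip[OF H])
  have U_diff: "U (x - y) = U x - U y" if "x \<in> M" "y \<in> M" for x y
    by (rule diff_if_adjoint[OF H, of M U N Us]) (use U_in U_Us M_diff N_diff that in auto)
  have Us_diff: "Us (x - y) = Us x - Us y" if "x \<in> N" "y \<in> N" for x y
    by (rule diff_if_adjoint[OF H, of N Us M U]) (use Us_in Us_U M_diff N_diff that in auto)
  have U_0: "U 0 = 0" using U_diff[OF M_0 M_0] by simp
  have Us_0: "Us 0 = 0" using Us_diff[OF N_0 N_0] by simp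
  have UUsU: "U (Us (U x)) = U x" if "x \<in> M" for x
    using U_pi that by (simp add: Us_def)
  \<comment> \<open>The adjoint form of \<open>U (Us (U z)) = U z\<close>.\<close>
  have UsUUs: "Us (U (Us y)) = Us y" if "y \<in> N" for y
  proof (rule eq_if_ip_eq[OF H, of _ M])
    fix z assume z: "z \<in> M"
    have "ip z (Us (U (Us y))) = ip (U (Us (U z))) y"
      using z that by (metis U_Us U_in Us_U Us_in)
    then show "ip z (Us (U (Us y))) = ip z (Us y)"
      using z that by (simp add: UUsU U_Us)
  qed (use that Us_in U_in M_diff in auto)
  have Us_range: "Us ` N = hclosure ip (T ` M)"
    using range_Ustar by (simp add: Us_def T_def)
  have Q0_in: "Q0 y \<in> N" if "y \<in> N" for y
    using Q0_op that by (simp add: adj_between_def)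
  have Us_Q0: "Us (Q0 y) = 0" if "y \<in> N" for y
    using Ustar_Q0 that by (simp add: Us_def)

  define Q22 where "Q22 = (\<lambda>y. U (Us y - A (Us y)) + Q0 y)"
  define kA where "kA \<longleftrightarrow> sub_kern M A = {0}"
  define kIA where "kIA \<longleftrightarrow> sub_kern M (\<lambda>x. x - A x) = {0}"
  define kT where "kT \<longleftrightarrow> sub_kern M T = {0}"
  define kUs where "kUs \<longleftrightarrow> sub_kern N Us = {0}"
  define kQ where "kQ \<longleftrightarrow> sub_kern N Q22 = {0}"
  define kIQ where "kIQ \<longleftrightarrow> sub_kern N (\<lambda>y. y - Q22 y) = {0}"
  define unitary where "unitary \<longleftrightarrow> (\<forall>x\<in>M. Us (U x) = x) \<and> (\<forall>y\<in>N. U (Us y) = y)"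

  have Q0_0: "Q0 0 = 0"
    using diff_if_adjoint[OF H, of N Q0 N Q0 0 0] Q0_in Q0_proj(2) N_diff N_0 by simp
  have Q22_0: "Q22 0 = 0" by (simp add: Q22_def Us_0 A_0 U_0 Q0_0)
  have kA: "kA \<longleftrightarrow> (\<forall>x\<in>M. A x = 0 \<longrightarrow> x = 0)"
    unfolding kA_def sub_kern_def using M_0 A_0 by blast
  have kIA: "kIA \<longleftrightarrow> (\<forall>x\<in>M. x - A x = 0 \<longrightarrow> x = 0)"
    unfolding kIA_def sub_kern_def using M_0 A_0 by fastforce
  have kT: "kT \<longleftrightarrow> (\<forall>x\<in>M. T x = 0 \<longrightarrow> x = 0)"
    unfolding kT_def sub_kern_def using M_0 T_0 by blast
  have kUs: "kUs \<longleftrightarrow> (\<forall>y\<in>N. Us y = 0 \<longrightarrow> y = 0)"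
    unfolding kUs_def sub_kern_def using N_0 Us_0 by blast
  have kQ: "kQ \<longleftrightarrow> (\<forall>y\<in>N. Q22 y = 0 \<longrightarrow> y = 0)"
    unfolding kQ_def sub_kern_def using N_0 Q22_0 by blast
  have kIQ: "kIQ \<longleftrightarrow> (\<forall>y\<in>N. y - Q22 y = 0 \<longrightarrow> y = 0)"
    unfolding kIQ_def sub_kern_def using N_0 Q22_0 by fastforce

  have T_eq: "T x = A (A x - x)" if "x \<in> M" for x
    using that by (simp add: T_def A_diff A_in)
  have c12: "kA \<and> kIA \<longleftrightarrow> kT"
  proof
    assume k: "kA \<and> kIA"
    show kT unfolding kT
    proof (intro ballI impI)
      fix x assume x: "x \<in> M" "T x = 0"
      then have "A x - x = 0" using k T_eq A_in M_diff unfolding kA by metis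
      then show "x = 0" using k x unfolding kIA by simp
    qed
  next
    assume k: kT
    show "kA \<and> kIA" unfolding kA kIA
    proof (intro conjI ballI impI)
      fix x assume "x \<in> M" "A x = 0"
      then show "x = 0" using k A_0 unfolding kT by (simp add: T_def)
    next
      fix x assume "x \<in> M" "x - A x = 0"
      then show "x = 0" using k unfolding kT by (simp add: T_def)
    qed
  qed
  have isometry: "\<forall>x\<in>M. Us (U x) = x" if kT
  proof
    fix x assume x: "x \<in> M"
    define z where "z = x - Us (U x)"
    have z: "z \<in> M" using x U_in Us_in M_diff by (simp add: z_def)
    have Uz: "U z = 0" using x U_in Us_in by (simp add: z_def U_diff UUsU)
    \<comment> \<open>\<open>U z = 0\<close> makes \<open>z\<close> orthogonal to the range of
      \<open>Us\<close>, which contains the range of \<open>T\<close>. By self-adjointness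
      \<open>T z\<close> is then orthogonal to all of \<open>M\<close>.\<close>
    have "ip w (T z) = ip w 0" if w: "w \<in> M" for w
    proof -
      obtain y where y: "y \<in> N" "T w = Us y"
        using Us_range subset_hclosure[OF H, of "T ` M"] w by blast
      have "ip w (T z) = ip (Us y) z" using T_sa[OF w z] y by simp
      also have "\<dots> = 0" using Us_U[OF z y(1)] Uz by (simp add: ip_zero_right[OF H])
      finally show ?thesis by (simp add: ip_zero_right[OF H])
    qed
    then have "T z = 0"
      using eq_if_ip_eq[OF H, of "T z" M 0] T_in[OF z] M_0 M_diff by blast
    then have "z = 0" using \<open>kT\<close> z unfolding kT by blast
    then show "Us (U x) = x" by (simp add: z_def)
  qed
  have c23: "kT \<and> kUs \<longleftrightarrow> unitary"
  proof
    assume k: "kT \<and> kUs"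
    have "U (Us y) = y" if y: "y \<in> N" for y
    proof -
      have "Us (U (Us y) - y) = 0" using y Us_in U_in by (simp add: Us_diff UsUUs)
      then show ?thesis using k y Us_in U_in N_diff unfolding kUs by fastforce
    qed
    then show unitary using isometry k by (simp add: unitary_def)
  next
    assume u: unitary
    have kT unfolding kT
    proof (intro ballI impI)
      fix x assume x: "x \<in> M" "T x = 0"
      \<comment> \<open>The witness is \<open>U x\<close>, since \<open>Us (U x) = x\<close>. So
        \<open>x\<close> lies in the closure of the range of \<open>T\<close>, to which
        \<open>T x = 0\<close> makes it orthogonal.\<close>
      have "x \<in> Us ` N" using u x U_in unfolding unitary_def by (metis imageI)
      then have "x \<in> hclosure ip (T ` M)" by (simp only: Us_range)
      then show "x = 0"
        by (rule hclosure_inter_orth[OF H]) (use x T_sa in \<open>auto simp: ip_zero_right[OF H]\<close>)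
    qed
    moreover have kUs using u U_0 unfolding kUs unitary_def by metis
    ultimately show "kT \<and> kUs" by simp
  qed
  have c34: "unitary \<longleftrightarrow> kA \<and> kIA \<and> kQ \<and> kIQ"
  proof
    assume u: unitary
    then have k: kA kIA kT kUs using c12 c23 by auto
    \<comment> \<open>\<open>Us\<close> annihilates \<open>Q0 y\<close> and is injective here, so
      \<open>Q0\<close> vanishes on \<open>N\<close>. Thus \<open>Us\<close> carries
      \<open>Q22\<close> to \<open>1 - A\<close>, and \<open>1 - Q22\<close> to
      \<open>A\<close>.\<close>
    have Q22: "Q22 y = U (Us y - A (Us y))" if y: "y \<in> N" for y
      using k(4) Us_Q0[OF y] Q0_in[OF y] unfolding kUs by (simp add: Q22_def)
    have Us_Q22: "Us (Q22 y) = Us y - A (Us y)" if y: "y \<in> N" for y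
      using u Q22[OF y] M_diff A_in Us_in[OF y] by (simp add: unitary_def)
    have kQ unfolding kQ
    proof (intro ballI impI)
      fix y assume y: "y \<in> N" "Q22 y = 0"
      then have "Us y = 0" using Us_Q22[OF y(1)] k(2) Us_in[OF y(1)] Us_0 unfolding kIA by simp
      then show "y = 0" using k(4) y unfolding kUs by blast
    qed
    moreover have kIQ unfolding kIQ
    proof (intro ballI impI)
      fix y assume y: "y \<in> N" "y - Q22 y = 0"
      then have "A (Us y) = 0" using Us_Q22[OF y(1)] by simp
      then have "Us y = 0" using k(1) Us_in[OF y(1)] unfolding kA by blast
      then show "y = 0" using k(4) y unfolding kUs by blast
    qed
    ultimately show "kA \<and> kIA \<and> kQ \<and> kIQ" using k by simp
  next
    assume k: "kA \<and> kIA \<and> kQ \<and> kIQ"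
    have kUs unfolding kUs
    proof (intro ballI impI)
      fix y assume y: "y \<in> N" "Us y = 0"
      have eq: "Q22 v = Q0 v" if "Us v = 0" for v
        using that by (simp add: Q22_def A_0 U_0)
      \<comment> \<open>On the kernel of \<open>Us\<close>, \<open>Q22\<close> coincides with
        \<open>Q0\<close>, and \<open>Q0 y\<close> lies in that kernel. So \<open>Q22\<close> fixes
        \<open>Q0 y\<close>, whence \<open>Q0 y = 0\<close> by \<open>kIQ\<close>; then
        \<open>Q22 y = Q0 y = 0\<close> and \<open>kQ\<close> gives \<open>y = 0\<close>.\<close>
      have "Q22 (Q0 y) = Q0 y" using eq[OF Us_Q0[OF y(1)]] Q0_proj(1) y by simp
      then have "Q0 y = 0" using k Q0_in[OF y(1)] unfolding kIQ by simp
      then show "y = 0" using k y eq[OF y(2)] unfolding kQ by simp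
    qed
    then show unitary using c12 c23 k by blast
  qed
  have "(kA \<and> kIA \<and> kUs \<longleftrightarrow> kT \<and> kUs) \<and> (kT \<and> kUs \<longleftrightarrow> unitary)
      \<and> (unitary \<longleftrightarrow> kA \<and> kIA \<and> kQ \<and> kIQ)"
    using c12 c23 c34 by blast
  then show ?thesis
    unfolding kA_def kIA_def kT_def kUs_def kQ_def kIQ_def unitary_def Q22_def Us_def T_def M_def N_def Let_def .
qed

end
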